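(* Consider the parametrized optimal control system, the estimator, and the errors $\tilde{\boldsymbol\theta}_t,\tilde{\boldsymbol\theta}_t^-,\boldsymbol e_t$ defined in the context, with true parameter $\boldsymbol\theta^*\in\mathbb R^p$ satisfying $L(\boldsymbol\xi(\boldsymbol\theta^* ))=0$. At every step the Jacobian $\boldsymbol L_t$ is computed by the chain rule $\boldsymbol L_t=\frac{\partial \boldsymbol l}{\partial\boldsymbol\xi_{\tau(t)}}\frac{\partial\boldsymbol\xi_{\tau(t)}(\boldsymbol\theta)}{\partial\boldsymbol\theta}\big|_{\boldsymbol\theta=\hat{\boldsymbol\theta}_t^-}$, with $\frac{\partial\boldsymbol\xi(\boldsymbol\theta)}{\partial\boldsymbol\theta}$ produced by the gradient generator described in the context. Assume: (1) $\boldsymbol L_t$ has full rank (rank $p$) for every $\hat{\boldsymbol\theta}_t^-$; (2) $\boldsymbol L_t$ is uniformly bounded in $t$; (3) for diagonal matrices $\mathcal F_t\in\mathbb R^{r\times r}$ and $\mathcal G_t\in\mathbb R^{p\times p}$ with $\mathcal F_t\boldsymbol e_t=\boldsymbol L_t\tilde{\boldsymbol\theta}_t^-$ and $\tilde{\boldsymbol\theta}_t^-=\mathcal G_t\tilde{\boldsymbol\theta}_{t-1}$, the following matrix inequalities hold for all $t$: $$(\mathcal F_t-\boldsymbol I_r)^2\le \boldsymbol R_t(\boldsymbol L_t\boldsymbol P_t^-\boldsymbol L_t'+\boldsymbol R_t)^{-1},\qquad \mathcal G_t'\boldsymbol P_t^{-1}\mathcal G_t-\boldsymbol P_t^{-1}\le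 0 .$$ Then estimating $\boldsymbol\theta^*$ by this estimator ensures local asymptotic convergence of the cumulative loss to $0$: for initial estimates $\hat{\boldsymbol\theta}_0$ in some neighbourhood of $\boldsymbol\theta^*$ for which (1)–(3) hold along the run, $$\lim_{t\to\infty}L(\boldsymbol\xi(\hat{\boldsymbol\theta}_t))=0 .$$
   Context: Primes denote transposes, $\|\cdot\|$ is the Euclidean norm, and matrix inequalities $A\le B$ mean $B-A$ is positive semidefinite. Optimal control system. Fix a horizon $T$, an initial state $\boldsymbol x_0\in\mathbb R^n$, and twice-differentiable maps $\boldsymbol f:\mathbb R^n\times\mathbb R^m\times\mathbb R^p\to\mathbb R^n$ (dynamics), $c:\mathbb R^n\times\mathbb R^m\times\mathbb R^p\to\mathbb R$ (running cost), and $h:\mathbb R^n\times\mathbb R^p\to\mathbb R$ (final cost). For $\boldsymbol\theta\in\mathbb R^p$, let $\{\boldsymbol x_{1:T}(\boldsymbol\theta),\boldsymbol u_{0:T-1}(\boldsymbol\theta)\}$ be the minimizer over $(\boldsymbol x_{1:T},\boldsymbol u_{0:T-1})$ of $\sum_{t=0}^{T-1}c(\boldsymbol x_t,\boldsymbol u_t,\boldsymbol\theta)+h(\boldsymbol x_T,\boldsymbol\theta)$ subject to $\boldsymbol x_{t+1}=\boldsymbol f(\boldsymbol x_t,\boldsymbol u_t,\boldsymbol\theta)$ with $\boldsymbol x_0$ given. Write $\boldsymbol\xi(\boldsymbol\theta)$ for the whole trajectory and $\boldsymbol\xi_t(\boldsymbol\theta)=(\boldsymbol x_t(\boldsymbol\theta),\boldsymbol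 u_t(\boldsymbol\theta))$ for its slice at time $t$ (with the convention $\boldsymbol u_T=\boldsymbol 0$). These are assumed to be differentiable in $\boldsymbol\theta$ where derivatives are taken. Measurements and loss. $\boldsymbol h:\mathbb R^{n+m}\to\mathbb R^r$ (bold, distinct from the final cost $h$) is a twice-differentiable measurement function. The measurements are $\boldsymbol O_t=\boldsymbol h(\boldsymbol\xi_t(\boldsymbol\theta^* ))+\boldsymbol v_t\in\mathbb R^r$, $t=0,\dots,T$, where $\boldsymbol v_t$ is measurement noise modelled as $\mathcal N(\boldsymbol 0,\boldsymbol R_t)$ with covariance $\boldsymbol R_t\in\mathbb R^{r\times r}$. The signed residual is $\boldsymbol l(\boldsymbol\xi_t(\boldsymbol\theta),\boldsymbol O_t)=\boldsymbol O_t-\boldsymbol h(\boldsymbol\xi_t(\boldsymbol\theta))$, and the cumulative loss, assumed twice differentiable, is $L(\boldsymbol\xi(\boldsymbol\theta))=\sum_{t=0}^T\|\boldsymbol l(\boldsymbol\xi_t(\boldsymbol\theta),\boldsymbol O_t)\|^2$. For the convergence analysis it is assumed that $L(\boldsymbol\xi(\boldsymbol\theta^* ))=0$, i.e. $\boldsymbol O_t=\boldsymbol h(\boldsymbol\xi_t(\boldsymbol\theta^* ))$. The $\boldsymbol R_t$ remain as covariance matrices used in the estimator. Estimator (extended Kalman filter for the system $\boldsymbol\theta_{t+1}=\boldsymbol\theta_t$, $\boldsymbol\theta_0=\boldsymbol\theta^*$). The steps are $t=1,2,\dots$. Step $t$ uses the slice and measurement with time index $\tau(t)\in\{0,\dots,T\}$,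 where $\tau(t)=t$ for $t\le T$; for $t>T$ the data of the trajectory are re-used. Start from $\hat{\boldsymbol\theta}_0\in\mathbb R^p$ and a positive definite $\boldsymbol P_0\in\mathbb R^{p\times p}$, and set $$\hat{\boldsymbol\theta}_t^-=\hat{\boldsymbol\theta}_{t-1},\quad \boldsymbol P_t^-=\boldsymbol P_{t-1},\quad \boldsymbol L_t=\frac{d\,\boldsymbol l(\boldsymbol\xi_{\tau(t)}(\boldsymbol\theta),\boldsymbol O_{\tau(t)})}{d\boldsymbol\theta}\Big|_{\boldsymbol\theta=\hat{\boldsymbol\theta}_t^-}\in\mathbb R^{r\times p},$$ $$\boldsymbol K_t=\boldsymbol P_t^-\boldsymbol L_t'(\boldsymbol L_t\boldsymbol P_t^-\boldsymbol L_t'+\boldsymbol R_t)^{-1},\quad \boldsymbol P_t=(\boldsymbol I_p-\boldsymbol K_t\boldsymbol L_t)\boldsymbol P_t^-,\quad \hat{\boldsymbol\theta}_t=\hat{\boldsymbol\theta}_t^--\boldsymbol K_t\big(\boldsymbol O_{\tau(t)}-\boldsymbol h(\boldsymbol\xi_{\tau(t)}(\hat{\boldsymbol\theta}_t^-))\big).$$ Errors: $\tilde{\boldsymbol\theta}_t=\boldsymbol\theta^*-\hat{\boldsymbol\theta}_t$, $\tilde{\boldsymbol\theta}_t^-=\boldsymbol\theta^*-\hat{\boldsymbol\theta}_t^-$, $\boldsymbol e_t=\boldsymbol l(\boldsymbol\xi_{\tau(t)}(\boldsymbol\theta^* ),\boldsymbol O_{\tau(t)})-\boldsymbol l(\boldsymbol\xi_{\tau(t)}(\hat{\boldsymbol\theta}_t^-),\boldsymbol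 O_{\tau(t)})$. Gradient generator. Given $\boldsymbol\theta$ and the trajectory $\boldsymbol\xi(\boldsymbol\theta)$, define multipliers by $\boldsymbol\lambda_T=\frac{\partial h}{\partial\boldsymbol x_T}$ and $\boldsymbol\lambda_t=\frac{\partial c}{\partial\boldsymbol x_t}+\big(\frac{\partial\boldsymbol f}{\partial\boldsymbol x_t}\big)'\boldsymbol\lambda_{t+1}$ for $t=T-1,\dots,1$, and the Hamiltonian $H_t=c(\boldsymbol x_t,\boldsymbol u_t,\boldsymbol\theta)+\boldsymbol f(\boldsymbol x_t,\boldsymbol u_t,\boldsymbol\theta)'\boldsymbol\lambda_{t+1}$. Along the trajectory let $\boldsymbol F_t=\frac{\partial\boldsymbol f}{\partial\boldsymbol x_t}$, $\boldsymbol G_t=\frac{\partial\boldsymbol f}{\partial\boldsymbol u_t}$, $\boldsymbol E_t=\frac{\partial\boldsymbol f}{\partial\boldsymbol\theta}$. Let $\boldsymbol H_t^{xx},\boldsymbol H_t^{xu}=(\boldsymbol H_t^{ux})',\boldsymbol H_t^{uu},\boldsymbol H_t^{x\theta},\boldsymbol H_t^{u\theta}$ be the corresponding second partial derivatives of $H_t$, and let $\boldsymbol H_T^{xx},\boldsymbol H_T^{x\theta}$ be those of $h$. With $\boldsymbol H_t^{uu}$ invertible for $t=0,\dots,T-1$, put $\boldsymbol A_t=\boldsymbol F_t-\boldsymbol G_t(\boldsymbol H_t^{uu})^{-1}\boldsymbol H_t^{ux}$, $\boldsymbol B_t=\boldsymbol G_t(\boldsymbol H_t^{uu})^{-1}\boldsymbol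 G_t'$, $\boldsymbol M_t=\boldsymbol E_t-\boldsymbol G_t(\boldsymbol H_t^{uu})^{-1}\boldsymbol H_t^{u\theta}$, $\boldsymbol C_t=\boldsymbol H_t^{xx}-\boldsymbol H_t^{xu}(\boldsymbol H_t^{uu})^{-1}\boldsymbol H_t^{ux}$, $\boldsymbol N_t=\boldsymbol H_t^{x\theta}-\boldsymbol H_t^{xu}(\boldsymbol H_t^{uu})^{-1}\boldsymbol H_t^{u\theta}$. Backward pass, from $\boldsymbol V_T=\boldsymbol H_T^{xx}$, $\boldsymbol W_T=\boldsymbol H_T^{x\theta}$: $\boldsymbol V_t=\boldsymbol C_t+\boldsymbol A_t'(\boldsymbol I+\boldsymbol V_{t+1}\boldsymbol B_t)^{-1}\boldsymbol V_{t+1}\boldsymbol A_t$, $\boldsymbol W_t=\boldsymbol A_t'(\boldsymbol I+\boldsymbol V_{t+1}\boldsymbol B_t)^{-1}(\boldsymbol W_{t+1}+\boldsymbol V_{t+1}\boldsymbol M_t)+\boldsymbol N_t$. Forward pass, from $\boldsymbol X_0=\boldsymbol 0$: $\boldsymbol U_t=-(\boldsymbol H_t^{uu})^{-1}\big(\boldsymbol H_t^{ux}\boldsymbol X_t+\boldsymbol H_t^{u\theta}+\boldsymbol G_t'(\boldsymbol I+\boldsymbol V_{t+1}\boldsymbol B_t)^{-1}(\boldsymbol V_{t+1}\boldsymbol A_t\boldsymbol X_t+\boldsymbol V_{t+1}\boldsymbol M_t+\boldsymbol W_{t+1})\big)$, $\boldsymbol X_{t+1}=\boldsymbol F_t\boldsymbol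 X_t+\boldsymbol G_t\boldsymbol U_t+\boldsymbol E_t$. The output is $\boldsymbol X_t=\frac{\partial\boldsymbol x_t(\boldsymbol\theta)}{\partial\boldsymbol\theta}$, $\boldsymbol U_t=\frac{\partial\boldsymbol u_t(\boldsymbol\theta)}{\partial\boldsymbol\theta}$, i.e. $\frac{\partial\boldsymbol\xi(\boldsymbol\theta)}{\partial\boldsymbol\theta}$; this is a known result giving the exact derivative.
   Formalization: The optimal trajectory is assumed continuously differentiable in θ (not merely differentiable), and the Jacobians are assumed of rank p for all θ near θ*, not only along the run; without these the claim fails. The covariances R_t are taken positive definite. *)

theory Defs
  imports "HOL-Analysis.Analysis"
begin

section \<open>Matrices and derivatives\<close>

definition diagonal_matrix :: "real^'a^'a \<Rightarrow> bool" where
  "diagonal_matrix A \<longleftrightarrow> (\<forall>i j. i \<noteq> j \<longrightarrow> A $ i $ j = 0)"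

definition pos_definite :: "real^'a^'a \<Rightarrow> bool" where
  "pos_definite A \<longleftrightarrow> transpose A = A \<and> (\<forall>x. x \<noteq> 0 \<longrightarrow> 0 < x \<bullet> (A *v x))"

text \<open>Positive semidefiniteness of \<open>B - A\<close> is meant in the sense of the quadratic form. Symmetry is
  not part of it, because the order is also applied to products of symmetric matrices. Wherever
  the order occurs in a hypothesis, this is the weaker requirement.\<close>

definition pos_semidefinite :: "real^'a^'a \<Rightarrow> bool" where
  "pos_semidefinite A \<longleftrightarrow> (\<forall>x. 0 \<le> x \<bullet> (A *v x))"

definition matrix_le :: "real^'a^'a \<Rightarrow> real^'a^'a \<Rightarrow> bool"  (infix "\<preceq>" 50) where
  "A \<preceq> B \<longleftrightarrow> pos_semidefinite (B - A)"

definition gradient :: "(real^'a \<Rightarrow> real) \<Rightarrow> real^'a \<Rightarrow> real^'a" where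
  "gradient g x = (\<chi> i. frechet_derivative g (at x) (axis i 1))"

definition twice_differentiable :: "('a::real_normed_vector \<Rightarrow> 'b::real_normed_vector) \<Rightarrow> bool" where
  "twice_differentiable g \<longleftrightarrow>
     (\<exists>D :: 'a \<Rightarrow> 'a \<Rightarrow>\<^sub>L 'b. \<forall>x. (g has_derivative blinfun_apply (D x)) (at x) \<and> D differentiable (at x))"

definition continuously_differentiable ::
    "('a::real_normed_vector \<Rightarrow> 'b::real_normed_vector) \<Rightarrow> bool" where
  "continuously_differentiable g \<longleftrightarrow>
     (\<exists>D :: 'a \<Rightarrow> 'a \<Rightarrow>\<^sub>L 'b. (\<forall>x. (g has_derivative blinfun_apply (D x)) (at x)) \<and> continuous_on UNIV D)"

definition stack_vec :: "real^'n \<Rightarrow> real^'m \<Rightarrow> real^('n + 'm)" where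
  "stack_vec x u = (\<chi> i. case i of Inl a \<Rightarrow> x $ a | Inr b \<Rightarrow> u $ b)"

definition stack_rows :: "real^'p^'n \<Rightarrow> real^'p^'m \<Rightarrow> real^'p^('n + 'm)" where
  "stack_rows X U = (\<chi> i. case i of Inl a \<Rightarrow> X $ a | Inr b \<Rightarrow> U $ b)"


section \<open>Parametrized optimal control system\<close>

record ('n, 'm, 'p) ocs =
  horizon :: nat
  init :: "real^'n"
  dyn :: "real^'n \<Rightarrow> real^'m \<Rightarrow> real^'p \<Rightarrow> real^'n"
  rcost :: "real^'n \<Rightarrow> real^'m \<Rightarrow> real^'p \<Rightarrow> real"
  fcost :: "real^'n \<Rightarrow> real^'p \<Rightarrow> real"

definition smooth_ocs :: "('n::finite, 'm::finite, 'p::finite) ocs \<Rightarrow> bool" where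
  "smooth_ocs S \<longleftrightarrow>
     twice_differentiable (\<lambda>(x, u, \<theta>). dyn S x u \<theta>) \<and>
     twice_differentiable (\<lambda>(x, u, \<theta>). rcost S x u \<theta>) \<and>
     twice_differentiable (\<lambda>(x, \<theta>). fcost S x \<theta>)"

text \<open>A trajectory is a pair of sequences, of which only \<open>x 0, \<dots>, x T\<close> and \<open>u 0, \<dots>, u (T - 1)\<close>
  matter, where \<open>T = horizon S\<close>.\<close>

definition feasible ::
    "('n::finite, 'm::finite, 'p::finite) ocs \<Rightarrow> real^'p \<Rightarrow> (nat \<Rightarrow> real^'n) \<Rightarrow> (nat \<Rightarrow> real^'m) \<Rightarrow> bool" where
  "feasible S \<theta> x u \<longleftrightarrow> x 0 = init S \<and> (\<forall>t<horizon S. x (Suc t) = dyn S (x t) (u t) \<theta>)"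

definition total_cost ::
    "('n::finite, 'm::finite, 'p::finite) ocs \<Rightarrow> real^'p \<Rightarrow> (nat \<Rightarrow> real^'n) \<Rightarrow> (nat \<Rightarrow> real^'m) \<Rightarrow> real" where
  "total_cost S \<theta> x u = (\<Sum>t<horizon S. rcost S (x t) (u t) \<theta>) + fcost S (x (horizon S)) \<theta>"

definition minimizer ::
    "('n::finite, 'm::finite, 'p::finite) ocs \<Rightarrow> real^'p \<Rightarrow> (nat \<Rightarrow> real^'n) \<Rightarrow> (nat \<Rightarrow> real^'m) \<Rightarrow> bool" where
  "minimizer S \<theta> x u \<longleftrightarrow> feasible S \<theta> x u \<and>
     (\<forall>x' u'. feasible S \<theta> x' u' \<longrightarrow> total_cost S \<theta> x u \<le> total_cost S \<theta> x' u')"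

definition traj_slice ::
    "('n::finite, 'm::finite, 'p::finite) ocs \<Rightarrow> (nat \<Rightarrow> real^'n) \<Rightarrow> (nat \<Rightarrow> real^'m) \<Rightarrow> nat \<Rightarrow> real^('n + 'm)" where
  "traj_slice S x u t = stack_vec (x t) (if t < horizon S then u t else 0)"


section \<open>Gradient generator\<close>

text \<open>All quantities are taken at the parameter \<open>\<theta>\<close> along the trajectory \<open>x, u\<close>. For recursions that
  run backwards from the horizon, the value at times beyond the horizon is irrelevant (it is the
  terminal one).\<close>

definition F_mat where
  "F_mat S \<theta> x u t = jacobian (\<lambda>z. dyn S z (u t) \<theta>) (at (x t))"
  for S :: "('n::finite, 'm::finite, 'p::finite) ocs"

definition G_mat where
  "G_mat S \<theta> x u t = jacobian (\<lambda>w. dyn S (x t) w \<theta>) (at (u t))"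
  for S :: "('n::finite, 'm::finite, 'p::finite) ocs"

definition E_mat where
  "E_mat S \<theta> x u t = jacobian (\<lambda>\<eta>. dyn S (x t) (u t) \<eta>) (at \<theta>)"
  for S :: "('n::finite, 'm::finite, 'p::finite) ocs"

function costate ::
    "('n::finite, 'm::finite, 'p::finite) ocs \<Rightarrow> real^'p \<Rightarrow> (nat \<Rightarrow> real^'n) \<Rightarrow> (nat \<Rightarrow> real^'m) \<Rightarrow> nat \<Rightarrow> real^'n" where
  "costate S \<theta> x u t =
     (if t < horizon S
      then gradient (\<lambda>z. rcost S z (u t) \<theta>) (x t)
           + transpose (F_mat S \<theta> x u t) *v costate S \<theta> x u (Suc t)
      else gradient (\<lambda>z. fcost S z \<theta>) (x (horizon S)))"
  by auto
termination by (relation "Wellfounded.measure (\<lambda>(S, \<theta>, x, u, t). horizon S - t)") auto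

declare costate.simps [simp del]

text \<open>The multiplier is an argument of the Hamiltonian and is held fixed when the second partial
  derivatives are taken.\<close>

definition hamiltonian ::
    "('n::finite, 'm::finite, 'p::finite) ocs \<Rightarrow> real^'n \<Rightarrow> real^'n \<Rightarrow> real^'m \<Rightarrow> real^'p \<Rightarrow> real" where
  "hamiltonian S l x u \<theta> = rcost S x u \<theta> + dyn S x u \<theta> \<bullet> l"

definition Hxx where
  "Hxx S \<theta> x u t =
     jacobian (gradient (\<lambda>z. hamiltonian S (costate S \<theta> x u (Suc t)) z (u t) \<theta>)) (at (x t))"
  for S :: "('n::finite, 'm::finite, 'p::finite) ocs"

definition Huu where
  "Huu S \<theta> x u t =
     jacobian (gradient (\<lambda>w. hamiltonian S (costate S \<theta> x u (Suc t)) (x t) w \<theta>)) (at (u t))"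
  for S :: "('n::finite, 'm::finite, 'p::finite) ocs"

definition Hux where
  "Hux S \<theta> x u t =
     jacobian (\<lambda>z. gradient (\<lambda>w. hamiltonian S (costate S \<theta> x u (Suc t)) z w \<theta>) (u t)) (at (x t))"
  for S :: "('n::finite, 'm::finite, 'p::finite) ocs"

definition Hxu where
  "Hxu S \<theta> x u t = transpose (Hux S \<theta> x u t)"
  for S :: "('n::finite, 'm::finite, 'p::finite) ocs"

definition Hxth where
  "Hxth S \<theta> x u t =
     jacobian (\<lambda>\<eta>. gradient (\<lambda>z. hamiltonian S (costate S \<theta> x u (Suc t)) z (u t) \<eta>) (x t)) (at \<theta>)"
  for S :: "('n::finite, 'm::finite, 'p::finite) ocs"

definition Huth where
  "Huth S \<theta> x u t =
     jacobian (\<lambda>\<eta>. gradient (\<lambda>w. hamiltonian S (costate S \<theta> x u (Suc t)) (x t) w \<eta>) (u t)) (at \<theta>)"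
  for S :: "('n::finite, 'm::finite, 'p::finite) ocs"

definition HTxx where
  "HTxx S \<theta> x = jacobian (gradient (\<lambda>z. fcost S z \<theta>)) (at (x (horizon S)))"
  for S :: "('n::finite, 'm::finite, 'p::finite) ocs"

definition HTxth where
  "HTxth S \<theta> x = jacobian (\<lambda>\<eta>. gradient (\<lambda>z. fcost S z \<eta>) (x (horizon S))) (at \<theta>)"
  for S :: "('n::finite, 'm::finite, 'p::finite) ocs"

definition A_mat where
  "A_mat S \<theta> x u t =
     F_mat S \<theta> x u t - G_mat S \<theta> x u t ** matrix_inv (Huu S \<theta> x u t) ** Hux S \<theta> x u t"
  for S :: "('n::finite, 'm::finite, 'p::finite) ocs"

definition B_mat where
  "B_mat S \<theta> x u t =
     G_mat S \<theta> x u t ** matrix_inv (Huu S \<theta> x u t) ** transpose (G_mat S \<theta> x u t)"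
  for S :: "('n::finite, 'm::finite, 'p::finite) ocs"

definition M_mat where
  "M_mat S \<theta> x u t =
     E_mat S \<theta> x u t - G_mat S \<theta> x u t ** matrix_inv (Huu S \<theta> x u t) ** Huth S \<theta> x u t"
  for S :: "('n::finite, 'm::finite, 'p::finite) ocs"

definition C_mat where
  "C_mat S \<theta> x u t =
     Hxx S \<theta> x u t - Hxu S \<theta> x u t ** matrix_inv (Huu S \<theta> x u t) ** Hux S \<theta> x u t"
  for S :: "('n::finite, 'm::finite, 'p::finite) ocs"

definition N_mat where
  "N_mat S \<theta> x u t =
     Hxth S \<theta> x u t - Hxu S \<theta> x u t ** matrix_inv (Huu S \<theta> x u t) ** Huth S \<theta> x u t"
  for S :: "('n::finite, 'm::finite, 'p::finite) ocs"

function V_mat ::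
    "('n::finite, 'm::finite, 'p::finite) ocs \<Rightarrow> real^'p \<Rightarrow> (nat \<Rightarrow> real^'n) \<Rightarrow> (nat \<Rightarrow> real^'m) \<Rightarrow> nat \<Rightarrow> real^'n^'n" where
  "V_mat S \<theta> x u t =
     (if t < horizon S
      then C_mat S \<theta> x u t
           + transpose (A_mat S \<theta> x u t)
             ** matrix_inv (mat 1 + V_mat S \<theta> x u (Suc t) ** B_mat S \<theta> x u t)
             ** V_mat S \<theta> x u (Suc t) ** A_mat S \<theta> x u t
      else HTxx S \<theta> x)"
  by auto
termination by (relation "Wellfounded.measure (\<lambda>(S, \<theta>, x, u, t). horizon S - t)") auto

declare V_mat.simps [simp del]

function W_mat ::
    "('n::finite, 'm::finite, 'p::finite) ocs \<Rightarrow> real^'p \<Rightarrow> (nat \<Rightarrow> real^'n) \<Rightarrow> (nat \<Rightarrow> real^'m) \<Rightarrow> nat \<Rightarrow> real^'p^'n" where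
  "W_mat S \<theta> x u t =
     (if t < horizon S
      then transpose (A_mat S \<theta> x u t)
           ** matrix_inv (mat 1 + V_mat S \<theta> x u (Suc t) ** B_mat S \<theta> x u t)
           ** (W_mat S \<theta> x u (Suc t) + V_mat S \<theta> x u (Suc t) ** M_mat S \<theta> x u t)
           + N_mat S \<theta> x u t
      else HTxth S \<theta> x)"
  by auto
termination by (relation "Wellfounded.measure (\<lambda>(S, \<theta>, x, u, t). horizon S - t)") auto

declare W_mat.simps [simp del]

definition U_from_X where
  "U_from_X S \<theta> x u t X =
     - (matrix_inv (Huu S \<theta> x u t)
        ** (Hux S \<theta> x u t ** X + Huth S \<theta> x u t
            + transpose (G_mat S \<theta> x u t)
              ** matrix_inv (mat 1 + V_mat S \<theta> x u (Suc t) ** B_mat S \<theta> x u t)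
              ** (V_mat S \<theta> x u (Suc t) ** A_mat S \<theta> x u t ** X
                  + V_mat S \<theta> x u (Suc t) ** M_mat S \<theta> x u t + W_mat S \<theta> x u (Suc t))))"
  for S :: "('n::finite, 'm::finite, 'p::finite) ocs"

primrec X_mat ::
    "('n::finite, 'm::finite, 'p::finite) ocs \<Rightarrow> real^'p \<Rightarrow> (nat \<Rightarrow> real^'n) \<Rightarrow> (nat \<Rightarrow> real^'m) \<Rightarrow> nat \<Rightarrow> real^'p^'n" where
  "X_mat S \<theta> x u 0 = 0"
| "X_mat S \<theta> x u (Suc t) =
     F_mat S \<theta> x u t ** X_mat S \<theta> x u t
     + G_mat S \<theta> x u t ** U_from_X S \<theta> x u t (X_mat S \<theta> x u t)
     + E_mat S \<theta> x u t"

definition U_mat where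
  "U_mat S \<theta> x u t = U_from_X S \<theta> x u t (X_mat S \<theta> x u t)"
  for S :: "('n::finite, 'm::finite, 'p::finite) ocs"

definition generator_wellposed where
  "generator_wellposed S \<theta> x u \<longleftrightarrow>
     (\<forall>t<horizon S. invertible (Huu S \<theta> x u t) \<and>
        invertible (mat 1 + V_mat S \<theta> x u (Suc t) ** B_mat S \<theta> x u t))"
  for S :: "('n::finite, 'm::finite, 'p::finite) ocs"

text \<open>Generator output for the slice at time \<open>t\<close>. At the horizon the input is \<open>0\<close> by convention, hence
  so is its derivative.\<close>

definition slice_sens where
  "slice_sens S \<theta> x u t =
     stack_rows (X_mat S \<theta> x u t) (if t < horizon S then U_mat S \<theta> x u t else 0)"
  for S :: "('n::finite, 'm::finite, 'p::finite) ocs"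


section \<open>Residuals and loss\<close>

text \<open>From here on, \<open>xs \<theta>\<close> and \<open>us \<theta>\<close> are the optimal states and inputs for the parameter \<open>\<theta>\<close>, \<open>hm\<close> is
  the measurement function and \<open>obs\<close> the sequence of measurements.\<close>

definition residual :: "(real^'k \<Rightarrow> real^'r) \<Rightarrow> real^'k \<Rightarrow> real^'r \<Rightarrow> real^'r" where
  "residual hm \<xi> y = y - hm \<xi>"

definition traj_residual where
  "traj_residual S xs us hm obs s \<theta> = residual hm (traj_slice S (xs \<theta>) (us \<theta>) s) (obs s)"
  for S :: "('n::finite, 'm::finite, 'p::finite) ocs"

definition loss where
  "loss S xs us hm obs \<theta> = (\<Sum>s\<le>horizon S. (norm (traj_residual S xs us hm obs s \<theta>))\<^sup>2)"
  for S :: "('n::finite, 'm::finite, 'p::finite) ocs"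

definition residual_jacobian where
  "residual_jacobian S xs us hm obs s \<theta> =
     jacobian (\<lambda>\<xi>. residual hm \<xi> (obs s)) (at (traj_slice S (xs \<theta>) (us \<theta>) s))
     ** slice_sens S \<theta> (xs \<theta>) (us \<theta>) s"
  for S :: "('n::finite, 'm::finite, 'p::finite) ocs"


section \<open>Extended Kalman filter\<close>

text \<open>The filter is run on residual functions \<open>l s \<theta>\<close> with Jacobians \<open>J s \<theta>\<close> and covariances \<open>R s\<close>, all
  indexed by the trajectory time \<open>s\<close>. Step \<open>t \<ge> 1\<close> uses the data with index \<open>\<tau> t\<close>. The state after
  step \<open>t\<close> is the pair of the estimate and the matrix \<open>P\<close>.\<close>

definition kalman_gain :: "real^'p^'p \<Rightarrow> real^'p^'r \<Rightarrow> real^'r^'r \<Rightarrow> real^'r^'p" where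
  "kalman_gain P L R = P ** transpose L ** matrix_inv (L ** P ** transpose L + R)"

definition ekf_update ::
    "real^'r \<Rightarrow> real^'p^'r \<Rightarrow> real^'r^'r \<Rightarrow> (real^'p) \<times> (real^'p^'p) \<Rightarrow> (real^'p) \<times> (real^'p^'p)" where
  "ekf_update e L R = (\<lambda>(\<theta>, P). let K = kalman_gain P L R in (\<theta> - K *v e, (mat 1 - K ** L) ** P))"

primrec ekf ::
    "(nat \<Rightarrow> real^'p \<Rightarrow> real^'r) \<Rightarrow> (nat \<Rightarrow> real^'p \<Rightarrow> real^'p^'r) \<Rightarrow> (nat \<Rightarrow> real^'r^'r) \<Rightarrow> (nat \<Rightarrow> nat)
      \<Rightarrow> real^'p \<Rightarrow> real^'p^'p \<Rightarrow> nat \<Rightarrow> (real^'p) \<times> (real^'p^'p)" where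
  "ekf l J R \<tau> \<theta>0 P0 0 = (\<theta>0, P0)"
| "ekf l J R \<tau> \<theta>0 P0 (Suc t) =
     (let (\<theta>, P) = ekf l J R \<tau> \<theta>0 P0 t; s = \<tau> (Suc t)
      in ekf_update (l s \<theta>) (J s \<theta>) (R s) (\<theta>, P))"

definition estimate where
  "estimate l J R \<tau> \<theta>0 P0 t = fst (ekf l J R \<tau> \<theta>0 P0 t)"

definition covar where
  "covar l J R \<tau> \<theta>0 P0 t = snd (ekf l J R \<tau> \<theta>0 P0 t)"

definition prior_estimate where
  "prior_estimate l J R \<tau> \<theta>0 P0 t = estimate l J R \<tau> \<theta>0 P0 (t - 1)"

definition prior_covar where
  "prior_covar l J R \<tau> \<theta>0 P0 t = covar l J R \<tau> \<theta>0 P0 (t - 1)"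

definition step_jacobian where
  "step_jacobian l J R \<tau> \<theta>0 P0 t = J (\<tau> t) (prior_estimate l J R \<tau> \<theta>0 P0 t)"

definition est_error where
  "est_error \<theta>s l J R \<tau> \<theta>0 P0 t = \<theta>s - estimate l J R \<tau> \<theta>0 P0 t"

definition prior_error where
  "prior_error \<theta>s l J R \<tau> \<theta>0 P0 t = \<theta>s - prior_estimate l J R \<tau> \<theta>0 P0 t"

definition residual_error where
  "residual_error \<theta>s l J R \<tau> \<theta>0 P0 t = l (\<tau> t) \<theta>s - l (\<tau> t) (prior_estimate l J R \<tau> \<theta>0 P0 t)"

definition full_rank_along where
  "full_rank_along l J R \<tau> \<theta>0 P0 \<longleftrightarrow>
     (\<forall>t\<ge>1. rank (step_jacobian l J R \<tau> \<theta>0 P0 t) = CARD('p))"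
  for J :: "nat \<Rightarrow> real^'p \<Rightarrow> real^'p^'r"

definition bounded_along where
  "bounded_along l J R \<tau> \<theta>0 P0 \<longleftrightarrow> (\<exists>b. \<forall>t\<ge>1. norm (step_jacobian l J R \<tau> \<theta>0 P0 t) \<le> b)"

definition inequalities_along where
  "inequalities_along \<theta>s l J R \<tau> \<theta>0 P0 \<longleftrightarrow>
     (\<exists>(\<F> :: nat \<Rightarrow> real^'r^'r) (\<G> :: nat \<Rightarrow> real^'p^'p). \<forall>t\<ge>1.
        let L = step_jacobian l J R \<tau> \<theta>0 P0 t;
            Pm = prior_covar l J R \<tau> \<theta>0 P0 t;
            P = covar l J R \<tau> \<theta>0 P0 t
        in diagonal_matrix (\<F> t) \<and> diagonal_matrix (\<G> t) \<and>
           \<F> t *v residual_error \<theta>s l J R \<tau> \<theta>0 P0 t = L *v prior_error \<theta>s l J R \<tau> \<theta>0 P0 t \<and>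
           prior_error \<theta>s l J R \<tau> \<theta>0 P0 t = \<G> t *v est_error \<theta>s l J R \<tau> \<theta>0 P0 (t - 1) \<and>
           (\<F> t - mat 1) ** (\<F> t - mat 1)
             \<preceq> R (\<tau> t) ** matrix_inv (L ** Pm ** transpose L + R (\<tau> t)) \<and>
           transpose (\<G> t) ** matrix_inv P ** \<G> t - matrix_inv P \<preceq> 0)"
  for J :: "nat \<Rightarrow> real^'p \<Rightarrow> real^'p^'r"

end

theory Submission
  imports Defs
begin

text \<open>The filter is a recursive least-squares method, and close to \<open>\<theta>s\<close> the residuals are almost linear
  in the parameter. Three facts make the loss converge.

  The first concerns a single step. Write \<open>x\<close> for the error before the step, \<open>e\<close> for the residual
  error, \<open>Q\<close> for the inverse of \<open>P\<close>, and \<open>S = L P L' + R\<close>. The step replaces \<open>Q\<close> by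
  \<open>Q + L' R\<^sup>-\<^sup>1 L\<close>, and the quadratic form \<open>x \<bullet> Q x\<close> changes by exactly
  \<open>(L x - e) \<bullet> R\<^sup>-\<^sup>1 (L x - e) - e \<bullet> S\<^sup>-\<^sup>1 e\<close> (\<open>ekf_update_information\<close>). The first term is the damage
  done by nonlinearity, the second the gain of the measurement.

  The second is local. In a small ball around \<open>\<theta>s\<close> the linearization error \<open>L x - e\<close> is at most
  \<open>\<epsilon> |x|\<close>, while full rank of the Jacobian at \<open>\<theta>s\<close> gives \<open>|e| \<ge> c |x|\<close>. Since \<open>Q\<close> only grows, \<open>P\<close> and
  hence \<open>S\<close> stay bounded, so for small \<open>\<epsilon>\<close> the gain wins and the form drops by at least
  \<open>\<kappa> |x|\<^sup>2\<close> per step (\<open>ekf_update_decrease\<close>). Because \<open>Q\<close> dominates its initial value, a sublevel set of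
  the initial form keeps the run inside the ball. The drops sum to at most the initial value,
  so the squared errors are summable and the estimates tend to \<open>\<theta>s\<close> (\<open>ekf_local_convergence\<close>).

  The third is that the filter really uses the derivative of the residual. The matrices \<open>J\<close> come from
  the gradient generator, and the generator differentiates the optimality system: for all
  parameters the optimal trajectory satisfies the dynamics, the costate recursion and the stationarity
  of the Hamiltonian in the input (\<open>minimizer_stationary\<close>). Differentiating these identities in \<open>\<theta>\<close> gives
  a linear two-point boundary value problem, which the backward pass solves by the ansatz that the
  costate derivative is \<open>V X + W\<close> (\<open>riccati_step\<close>, \<open>generator_correct\<close>). The symmetry of second derivatives,
  proved under differentiability of the derivative at a single point, identifies the mixed blocks
  as transposes of one another.\<close>

section \<open>Matrices as bilinear forms\<close>

lemma inner_matrix_vector: "x \<bullet> (A *v y) = (transpose A *v x) \<bullet> y" for A :: "real^'n^'m"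
  by (simp add: dot_lmul_matrix)

lemma inner_transpose_vector: "x \<bullet> (transpose A *v y) = (A *v x) \<bullet> y" for A :: "real^'n^'m"
  by (metis inner_matrix_vector transpose_transpose)

lemma inner_left_eqI: "(\<And>k. k \<bullet> v = k \<bullet> w) \<Longrightarrow> v = w" for v w :: "'a::real_inner"
  using vector_eq_ldot by blast

lemma transpose_eq_selfI:
  fixes M :: "real^'n^'n"
  assumes "\<And>x y. x \<bullet> (M *v y) = (M *v x) \<bullet> y"
  shows "transpose M = M"
proof -
  have "transpose M *v x = M *v x" for x
    using assms[of x] by (metis inner_matrix_vector vector_eq_rdot)
  then show ?thesis by (simp add: matrix_eq del: transpose_matrix_vector)
qed

lemma matrix_inv_right_vector: "A *v (matrix_inv A *v x) = x"
  and matrix_inv_left_vector: "matrix_inv A *v (A *v x) = x"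
  if "invertible A" for A :: "real^'n^'n"
proof -
  have "A ** matrix_inv A = mat 1 \<and> matrix_inv A ** A = mat 1"
    using that unfolding invertible_def matrix_inv_def by (rule someI_ex)
  then show "A *v (matrix_inv A *v x) = x" "matrix_inv A *v (A *v x) = x"
    by (simp_all add: matrix_vector_mul_assoc)
qed

lemma matrix_vector_bound:
  fixes A :: "real^'n^'m"
  obtains b where "0 < b" and "\<And>x. norm (A *v x) \<le> b * norm x"
  using bounded_linear.pos_bounded[OF matrix_vector_mul_bounded_linear[of A]]
  by (metis mult.commute)

lemma transpose_vector_bound:
  fixes A :: "real^'n^'m"
  assumes "\<And>x. norm (A *v x) \<le> b * norm x"
  shows "norm (transpose A *v y) \<le> b * norm y"
proof (cases "transpose A *v y = 0")
  case True
  have "0 \<le> b * norm y"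
  proof -
    have "0 \<le> norm (A *v axis undefined 1)" by simp
    also have "\<dots> \<le> b" using assms[of "axis undefined 1"] by simp
    finally show ?thesis by simp
  qed
  then show ?thesis using True by simp
next
  case False
  let ?z = "transpose A *v y"
  have "norm ?z * norm ?z = y \<bullet> (A *v ?z)"
    using inner_matrix_vector[of y A ?z] by (simp only: power2_norm_eq_inner flip: power2_eq_square)
  also have "\<dots> \<le> norm y * norm (A *v ?z)" by (rule norm_cauchy_schwarz)
  also have "\<dots> \<le> norm y * (b * norm ?z)" by (intro mult_left_mono assms) simp
  finally show ?thesis using False by (simp add: algebra_simps)
qed

text \<open>Applied with \<open>y = A x\<close>, this bounds the inverse of a coercive matrix.\<close>

lemma norm_le_of_coercive:
  fixes q :: real
  assumes "0 < q" "q * (norm x)\<^sup>2 \<le> x \<bullet> y"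
  shows "q * norm x \<le> norm y"
proof (cases "x = 0")
  case False
  have "norm x * (q * norm x) \<le> norm x * norm y"
    using assms(2) norm_cauchy_schwarz[of x y] by (simp add: power2_eq_square algebra_simps)
  then show ?thesis using False by simp
qed simp

lemma coercive_invertible:
  fixes A :: "real^'n^'n"
  assumes "0 < q" "\<And>x. q * (norm x)\<^sup>2 \<le> x \<bullet> (A *v x)"
  shows "invertible A"
proof -
  have "x = 0" if "A *v x = 0" for x
    using norm_le_of_coercive[OF assms(1) assms(2), of x] that assms(1)
    by (simp add: mult_le_0_iff)
  then show ?thesis
    by (simp add: invertible_left_inverse matrix_left_invertible_ker)
qed

text \<open>The constant is the minimum of the quadratic form on the unit sphere, which is attained by
  compactness and positive there; homogeneity extends the bound to all vectors.\<close>

lemma pos_definite_coercive: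
  fixes A :: "real^'n^'n"
  assumes "pos_definite A"
  obtains q where "0 < q" "\<And>x. q * (norm x)\<^sup>2 \<le> x \<bullet> (A *v x)"
proof -
  let ?S = "sphere (0::real^'n) 1"
  have cont: "continuous_on ?S (\<lambda>x. x \<bullet> (A *v x))"
    by (intro continuous_intros)
  have "axis undefined 1 \<in> ?S" by simp
  then obtain y where y: "y \<in> ?S" "\<And>x. x \<in> ?S \<Longrightarrow> y \<bullet> (A *v y) \<le> x \<bullet> (A *v x)"
    using continuous_attains_inf[OF _ _ cont] by (metis compact_sphere empty_iff)
  show thesis
  proof
    show "0 < y \<bullet> (A *v y)"
      using assms y(1) unfolding pos_definite_def by (metis norm_zero mem_sphere_0 zero_neq_one)
    fix x :: "real^'n"
    show "y \<bullet> (A *v y) * (norm x)\<^sup>2 \<le> x \<bullet> (A *v x)"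
    proof (cases "x = 0")
      case False
      define c where "c = inverse (norm x)"
      have "y \<bullet> (A *v y) \<le> (c *\<^sub>R x) \<bullet> (A *v (c *\<^sub>R x))"
        using False by (intro y(2)) (simp add: c_def)
      also have "\<dots> = (x \<bullet> (A *v x)) / (norm x)\<^sup>2"
        by (simp add: matrix_vector_mult_scaleR c_def power2_eq_square divide_inverse)
      finally show ?thesis using False by (simp add: field_simps)
    qed simp
  qed
qed

lemma pos_definite_matrix_inv:
  fixes A :: "real^'n^'n"
  assumes "pos_definite A"
  shows "pos_definite (matrix_inv A)" "invertible A"
proof -
  obtain q where q: "0 < q" "\<And>x. q * (norm x)\<^sup>2 \<le> x \<bullet> (A *v x)"
    using pos_definite_coercive[OF assms] by blast
  show inv: "invertible A" by (rule coercive_invertible[OF q])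
  note Ai = matrix_inv_right_vector[OF inv]
  have sw: "x \<bullet> (A *v y) = (A *v x) \<bullet> y" for x y
    using inner_matrix_vector[of x A y] assms
    by (simp add: pos_definite_def del: transpose_matrix_vector)
  have "x \<bullet> (matrix_inv A *v y) = (matrix_inv A *v x) \<bullet> y" for x y
    using sw[of "matrix_inv A *v x" "matrix_inv A *v y"] by (simp add: Ai)
  moreover have "0 < x \<bullet> (matrix_inv A *v x)" if "x \<noteq> 0" for x
  proof -
    have "matrix_inv A *v x \<noteq> 0" using that Ai[of x] by auto
    then have "0 < (matrix_inv A *v x) \<bullet> (A *v (matrix_inv A *v x))"
      using assms unfolding pos_definite_def by blast
    then show ?thesis by (simp add: Ai inner_commute)
  qed
  ultimately show "pos_definite (matrix_inv A)"
    unfolding pos_definite_def by (blast intro: transpose_eq_selfI)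
qed

lemma norm_matrix_vector_le:
  fixes A :: "real^'n^'m"
  shows "norm (A *v x) \<le> norm A * norm x"
proof -
  have "norm (A *v x) \<le> L2_set (\<lambda>i. norm (A $ i) * norm x) UNIV"
    unfolding norm_vec_def[of "A *v x"]
    by (rule L2_set_mono) (simp_all add: matrix_vector_mul_component Cauchy_Schwarz_ineq2)
  then show ?thesis
    by (simp add: L2_set_left_distrib norm_vec_def[of A])
qed

section \<open>Symmetry of the second derivative\<close>

text \<open>Both orders of differentiation are compared with the same second difference of \<open>f\<close> over a
  parallelogram with sides \<open>s u\<close> and \<open>s v\<close>. The mean value theorem in the direction \<open>u\<close> turns it into a
  difference of first derivatives at two points close to \<open>a\<close>, to which the expansion of \<open>D\<close> at \<open>a\<close> applies.\<close>

lemma second_difference: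
  fixes f :: "'a::real_normed_vector \<Rightarrow> real" and D :: "'a \<Rightarrow> 'a \<Rightarrow>\<^sub>L real"
  assumes D: "\<And>x. (f has_derivative blinfun_apply (D x)) (at x)"
    and D2: "(D has_derivative D2) (at a)" and "0 < \<epsilon>"
  shows "\<exists>d>0. \<forall>s. 0 < s \<and> s < d \<longrightarrow>
    \<bar>f (a + s *\<^sub>R u + s *\<^sub>R v) - f (a + s *\<^sub>R u) - f (a + s *\<^sub>R v) + f a - s\<^sup>2 * D2 v u\<bar> \<le> \<epsilon> * s\<^sup>2"
proof -
  \<comment> \<open>\<open>s M\<close> bounds every displacement from \<open>a\<close> that occurs, and \<open>\<eta>\<close> absorbs the two error terms
    \<open>\<eta> (s M) M\<close> that the expansion of \<open>D\<close> produces.\<close>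
  define M where "M = 1 + norm u + norm v"
  have M: "1 \<le> M" "norm u \<le> M" by (simp_all add: M_def)
  define \<eta> where "\<eta> = \<epsilon> / (2 * M\<^sup>2)"
  have \<eta>: "0 < \<eta>" using M(1) assms(3) by (simp add: \<eta>_def)
  obtain d where d: "0 < d"
    "\<And>y. norm (y - a) < d \<Longrightarrow> norm (D y - D a - D2 (y - a)) \<le> \<eta> * norm (y - a)"
    using D2 \<eta> unfolding has_derivative_at_alt by blast
  have err: "\<bar>D (a + k) u - D a u - D2 k u\<bar> \<le> \<eta> * (s * M) * M"
    if "norm k \<le> s * M" "s * M < d" "0 < s" for k s
  proof -
    have "\<bar>D (a + k) u - D a u - D2 k u\<bar> \<le> norm (D (a + k) - D a - D2 k) * norm u"
      using norm_blinfun[of "D (a + k) - D a - D2 k" u] by (simp add: minus_blinfun.rep_eq)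
    also have "\<dots> \<le> (\<eta> * norm k) * norm u"
      using d(2)[of "a + k"] that by (intro mult_right_mono) auto
    also have "\<dots> \<le> (\<eta> * (s * M)) * M"
      using that M \<eta> by (intro mult_mono mult_left_mono) auto
    finally show ?thesis .
  qed
  have lin: "linear D2" using D2 by (rule has_derivative_linear)
  show ?thesis
  proof (intro exI[of _ "d / M"] conjI allI impI)
    show "0 < d / M" using d M by simp
    fix s assume s: "0 < s \<and> s < d / M"
    then have sM: "s * M < d" using M by (simp add: field_simps)
    define \<phi> where "\<phi> r = f (a + r *\<^sub>R u + s *\<^sub>R v) - f (a + r *\<^sub>R u)" for r
    have line: "((\<lambda>r. f (b + r *\<^sub>R u)) has_field_derivative D (b + r *\<^sub>R u) u) (at r)" for b r
    proof -
      have "((\<lambda>r. b + r *\<^sub>R u) has_derivative (\<lambda>h. h *\<^sub>R u)) (at r)"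
        by (auto intro!: derivative_eq_intros)
      from has_derivative_compose[OF this D] show ?thesis
        by (simp add: has_field_derivative_def blinfun.scaleR_right mult_commute_abs)
    qed
    have "(\<phi> has_field_derivative D (a + r *\<^sub>R u + s *\<^sub>R v) u - D (a + r *\<^sub>R u) u) (at r)" for r
    proof -
      have "a + r *\<^sub>R u + s *\<^sub>R v = a + s *\<^sub>R v + r *\<^sub>R u" for r by simp
      then show ?thesis
        using DERIV_diff[OF line[of "a + s *\<^sub>R v" r] line[of a r]] by (simp only: \<phi>_def[abs_def])
    qed
    then have "\<exists>r>0. r < s \<and> \<phi> s - \<phi> 0 =
        (s - 0) * (D (a + r *\<^sub>R u + s *\<^sub>R v) u - D (a + r *\<^sub>R u) u)"
      using s by (intro MVT2) auto
    then obtain r where r: "0 < r" "r < s"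
      "\<phi> s - \<phi> 0 = (s - 0) * (D (a + r *\<^sub>R u + s *\<^sub>R v) u - D (a + r *\<^sub>R u) u)"
      by blast
    have "norm (r *\<^sub>R u + s *\<^sub>R v) \<le> r * norm u + s * norm v"
      using norm_triangle_ineq[of "r *\<^sub>R u" "s *\<^sub>R v"] r s by simp
    also have "\<dots> \<le> s * norm u + s * norm v"
      using r by (simp add: mult_right_mono)
    also have "\<dots> \<le> s * M" using s by (simp add: M_def algebra_simps)
    finally have k1: "norm (r *\<^sub>R u + s *\<^sub>R v) \<le> s * M" .
    have k2: "norm (r *\<^sub>R u) \<le> s * M" using r M s by (simp add: mult_mono)
    have "D2 (r *\<^sub>R u + s *\<^sub>R v) u - D2 (r *\<^sub>R u) u = s * D2 v u"
      by (simp add: linear_add[OF lin] linear_cmul[OF lin] blinfun.add_left blinfun.scaleR_left)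
    then have "\<bar>D (a + r *\<^sub>R u + s *\<^sub>R v) u - D (a + r *\<^sub>R u) u - s * D2 v u\<bar> \<le> 2 * (\<eta> * (s * M) * M)"
      using err[OF k1 sM] err[OF k2 sM] s by (simp add: add.assoc)
    also have "\<dots> = \<epsilon> * s" using M(1) by (simp add: \<eta>_def power2_eq_square)
    finally have "s * \<bar>D (a + r *\<^sub>R u + s *\<^sub>R v) u - D (a + r *\<^sub>R u) u - s * D2 v u\<bar> \<le> s * (\<epsilon> * s)"
      using s by simp
    also have "s * \<bar>D (a + r *\<^sub>R u + s *\<^sub>R v) u - D (a + r *\<^sub>R u) u - s * D2 v u\<bar> = \<bar>\<phi> s - \<phi> 0 - s\<^sup>2 * D2 v u\<bar>"
    proof -
      have "\<phi> s - \<phi> 0 - s\<^sup>2 * D2 v u = s * (D (a + r *\<^sub>R u + s *\<^sub>R v) u - D (a + r *\<^sub>R u) u - s * D2 v u)"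
        unfolding r(3) by (simp add: power2_eq_square algebra_simps)
      then show ?thesis using s by (simp add: abs_mult)
    qed
    finally show "\<bar>f (a + s *\<^sub>R u + s *\<^sub>R v) - f (a + s *\<^sub>R u) - f (a + s *\<^sub>R v) + f a - s\<^sup>2 * D2 v u\<bar> \<le> \<epsilon> * s\<^sup>2"
      by (simp add: \<phi>_def power2_eq_square algebra_simps)
  qed
qed

text \<open>The second difference is symmetric in \<open>u\<close> and \<open>v\<close>, so both iterated derivatives are within
  \<open>\<epsilon>\<close> of the same quotient.\<close>

lemma symmetric_second_derivative:
  fixes f :: "'a::real_normed_vector \<Rightarrow> real" and D :: "'a \<Rightarrow> 'a \<Rightarrow>\<^sub>L real"
  assumes D: "\<And>x. (f has_derivative blinfun_apply (D x)) (at x)"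
    and D2: "(D has_derivative D2) (at a)"
  shows "D2 u v = D2 v u"
proof -
  have "\<bar>D2 u v - D2 v u\<bar> \<le> 0 + \<epsilon>" if e: "0 < \<epsilon>" for \<epsilon> :: real
  proof -
    define \<Delta> where "\<Delta> s = f (a + s *\<^sub>R u + s *\<^sub>R v) - f (a + s *\<^sub>R u) - f (a + s *\<^sub>R v) + f a" for s
    obtain d1 where d1: "0 < d1" "\<And>s. 0 < s \<Longrightarrow> s < d1 \<Longrightarrow> \<bar>\<Delta> s - s\<^sup>2 * D2 v u\<bar> \<le> \<epsilon> / 2 * s\<^sup>2"
      using second_difference[OF D D2, of "\<epsilon> / 2" u v] e unfolding \<Delta>_def by auto
    obtain d2 where d2: "0 < d2" "\<And>s. 0 < s \<Longrightarrow> s < d2 \<Longrightarrow> \<bar>\<Delta> s - s\<^sup>2 * D2 u v\<bar> \<le> \<epsilon> / 2 * s\<^sup>2"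
      using second_difference[OF D D2, of "\<epsilon> / 2" v u] e unfolding \<Delta>_def
      by (auto simp: algebra_simps)
    define s where "s = min d1 d2 / 2"
    have s: "0 < s" "s < d1" "s < d2" using d1 d2 by (auto simp: s_def)
    have "\<bar>s\<^sup>2 * D2 u v - s\<^sup>2 * D2 v u\<bar> \<le> \<epsilon> * s\<^sup>2"
      using d1(2)[OF s(1,2)] d2(2)[OF s(1,3)] by argo
    also have "\<bar>s\<^sup>2 * D2 u v - s\<^sup>2 * D2 v u\<bar> = s\<^sup>2 * \<bar>D2 u v - D2 v u\<bar>"
      by (simp add: abs_mult flip: right_diff_distrib)
    finally show ?thesis using s(1) by (simp add: mult.commute)
  qed
  then have "\<bar>D2 u v - D2 v u\<bar> \<le> 0" by (rule field_le_epsilon)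
  then show ?thesis by simp
qed

section \<open>Gradients and Jacobians as restrictions of derivatives\<close>

lemma jacobian_vector:
  fixes f :: "real^'a \<Rightarrow> real^'b"
  assumes "(f has_derivative f') (at x)"
  shows "jacobian f (at x) *v h = f' h"
  using assms by (simp add: jacobian_def matrix_works has_derivative_linear flip: frechet_derivative_at)

text \<open>The vector that represents the functional \<open>B\<close> on the range of \<open>\<iota>\<close>. With \<open>\<iota>\<close> the embedding of one
  argument of a function into the product of all its arguments, it is a partial gradient, and being
  linear in \<open>B\<close> it can be differentiated through.\<close>

definition partial_gradient :: "(real^'a \<Rightarrow> 'e::real_normed_vector) \<Rightarrow> ('e \<Rightarrow>\<^sub>L real) \<Rightarrow> real^'a" where
  "partial_gradient \<iota> B = (\<chi> i. B (\<iota> (axis i 1)))"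

lemma inner_partial_gradient:
  assumes "linear \<iota>"
  shows "k \<bullet> partial_gradient \<iota> B = blinfun_apply B (\<iota> k)"
proof -
  have lin: "linear (\<lambda>k. blinfun_apply B (\<iota> k))"
    using linear_compose[OF assms bounded_linear.linear[OF blinfun.bounded_linear_right[of B]]]
    by (simp add: o_def)
  have "blinfun_apply B (\<iota> (\<Sum>i\<in>UNIV. (k $ i) *\<^sub>R axis i 1)) =
      (\<Sum>i\<in>UNIV. (k $ i) *\<^sub>R blinfun_apply B (\<iota> (axis i 1)))"
    by (simp add: linear_sum[OF lin] linear_cmul[OF lin])
  then show ?thesis
    by (simp add: partial_gradient_def inner_vec_def basis_expansion flip: scalar_mult_eq_scaleR)
qed

lemma bounded_linear_partial_gradient: "bounded_linear (partial_gradient \<iota>)"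
proof -
  have "partial_gradient \<iota> = (\<lambda>B. \<Sum>i\<in>UNIV. blinfun_apply B (\<iota> (axis i 1)) *\<^sub>R axis i 1)"
    by (rule ext) (simp add: vec_eq_iff partial_gradient_def axis_def if_distrib cong: if_cong)
  then show ?thesis
    by (simp add: bounded_linear_sum bounded_linear_scaleR_const blinfun.bounded_linear_left)
qed

lemma gradient_eq_partial_gradient:
  assumes "(g has_derivative (\<lambda>h. blinfun_apply B (\<iota> h))) (at x)"
  shows "gradient g x = partial_gradient \<iota> B"
  using fun_cong[OF frechet_derivative_at[OF assms]]
  by (simp add: gradient_def partial_gradient_def vec_eq_iff)

lemma jacobian_partial_gradient:
  fixes B :: "real^'b \<Rightarrow> 'e::real_normed_vector \<Rightarrow>\<^sub>L real"
  assumes "(B has_derivative B') (at y)"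
  shows "jacobian (\<lambda>y. partial_gradient \<iota> (B y)) (at y) *v h = partial_gradient \<iota> (B' h)"
  by (rule jacobian_vector bounded_linear.has_derivative[OF bounded_linear_partial_gradient] assms)+

section \<open>Derivatives of the data of the control problem\<close>

text \<open>The locale fixes first and second derivatives of the joint functions of \<open>(x, u, \<theta>)\<close>, so that
  every matrix of the generator becomes one block of a single derivative.\<close>

locale differentiated_ocs =
  fixes S :: "('n::finite, 'm::finite, 'p::finite) ocs"
    and Df D2f Dc D2c Dh D2h
  assumes dyn: "\<And>z. ((\<lambda>(x, u, \<theta>). dyn S x u \<theta>) has_derivative blinfun_apply (Df z)) (at z)"
    and Df: "\<And>z. (Df has_derivative D2f z) (at z)"
    and rcost: "\<And>z. ((\<lambda>(x, u, \<theta>). rcost S x u \<theta>) has_derivative blinfun_apply (Dc z)) (at z)"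
    and Dc: "\<And>z. (Dc has_derivative D2c z) (at z)"
    and fcost: "\<And>z. ((\<lambda>(x, \<theta>). fcost S x \<theta>) has_derivative blinfun_apply (Dh z)) (at z)"
    and Dh: "\<And>z. (Dh has_derivative D2h z) (at z)"
begin

abbreviation "\<iota>x \<equiv> \<lambda>h::real^'n. (h, 0::real^'m, 0::real^'p)"
abbreviation "\<iota>u \<equiv> \<lambda>h::real^'m. (0::real^'n, h, 0::real^'p)"
abbreviation "\<iota>T \<equiv> \<lambda>h::real^'n. (h, 0::real^'p)"

lemma linear_embeddings: "linear \<iota>x" "linear \<iota>u" "linear \<iota>T"
  by (auto intro!: linearI)

text \<open>The joint first and second derivatives of the Hamiltonian in \<open>(x, u, \<theta>)\<close>, for a fixed multiplier.\<close>

definition DH where "DH \<mu> z = Dc z + (blinfun_inner_left \<mu> o\<^sub>L Df z)"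

definition D2H where "D2H \<mu> z k = D2c z k + (blinfun_inner_left \<mu> o\<^sub>L D2f z k)"

lemma DH_apply: "DH \<mu> z k = Dc z k + Df z k \<bullet> \<mu>"
  by (simp add: DH_def blinfun.add_left blinfun_inner_left.rep_eq)

lemma has_derivative_dyn:
  assumes "(x has_derivative x') (at a)" "(u has_derivative u') (at a)" "(p has_derivative p') (at a)"
  shows "((\<lambda>a. dyn S (x a) (u a) (p a)) has_derivative (\<lambda>h. Df (x a, u a, p a) (x' h, u' h, p' h))) (at a)"
  using has_derivative_compose[OF has_derivative_Pair[OF assms(1) has_derivative_Pair[OF assms(2,3)]] dyn]
  by simp

lemma has_derivative_rcost:
  assumes "(x has_derivative x') (at a)" "(u has_derivative u') (at a)" "(p has_derivative p') (at a)"
  shows "((\<lambda>a. rcost S (x a) (u a) (p a)) has_derivative (\<lambda>h. Dc (x a, u a, p a) (x' h, u' h, p' h))) (at a)"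
  using has_derivative_compose[OF has_derivative_Pair[OF assms(1) has_derivative_Pair[OF assms(2,3)]] rcost]
  by simp

lemma has_derivative_fcost:
  assumes "(x has_derivative x') (at a)" "(p has_derivative p') (at a)"
  shows "((\<lambda>a. fcost S (x a) (p a)) has_derivative (\<lambda>h. Dh (x a, p a) (x' h, p' h))) (at a)"
  using has_derivative_compose[OF has_derivative_Pair[OF assms] fcost]
  by simp

lemma has_derivative_hamiltonian:
  assumes "(x has_derivative x') (at a)" "(u has_derivative u') (at a)" "(p has_derivative p') (at a)"
  shows "((\<lambda>a. hamiltonian S \<mu> (x a) (u a) (p a)) has_derivative
          (\<lambda>h. DH \<mu> (x a, u a, p a) (x' h, u' h, p' h))) (at a)"
  unfolding hamiltonian_def DH_apply
  by (intro has_derivative_add has_derivative_rcost has_derivative_inner_left has_derivative_dyn assms)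

text \<open>The multiplier depends on the parameter as well. Since the Hamiltonian is affine in it, its
  variation contributes only first derivatives of the dynamics; they become the terms with
  the transposes of \<open>F\<close> and \<open>G\<close> in the differentiated optimality system.\<close>

lemma has_derivative_DH:
  assumes "(\<mu> has_derivative \<mu>') (at a)" "(z has_derivative z') (at a)"
  shows "((\<lambda>a. DH (\<mu> a) (z a)) has_derivative
           (\<lambda>h. D2H (\<mu> a) (z a) (z' h) + (blinfun_inner_left (\<mu>' h) o\<^sub>L Df (z a)))) (at a)"
  unfolding DH_def D2H_def
  by (rule derivative_eq_intros has_derivative_compose[OF assms(2) Dc]
      has_derivative_compose[OF assms(2) Df] assms
      bounded_bilinear.FDERIV[OF bounded_bilinear_blinfun_compose]
      bounded_linear.has_derivative[OF bounded_linear_blinfun_inner_left] refl)+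
     (simp add: fun_eq_iff algebra_simps)

lemma has_derivative_DH_fixed:
  assumes "(z has_derivative z') (at a)"
  shows "((\<lambda>a. DH \<mu> (z a)) has_derivative (\<lambda>h. D2H \<mu> (z a) (z' h))) (at a)"
  using has_derivative_DH[OF has_derivative_const assms, of \<mu>]
  by (simp add: linear_0[OF bounded_linear.linear[OF bounded_linear_blinfun_inner_left]])

lemma linear_D2H: "linear (D2H \<mu> z)"
  using has_derivative_DH_fixed[OF has_derivative_ident] by (rule has_derivative_linear)

lemma D2H_symmetric: "D2H \<mu> z j k = D2H \<mu> z k j"
proof (rule symmetric_second_derivative)
  show "((\<lambda>(x, u, \<theta>). hamiltonian S \<mu> x u \<theta>) has_derivative blinfun_apply (DH \<mu> y)) (at y)" for y
    using has_derivative_hamiltonian[OF has_derivative_fst[OF has_derivative_ident]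
        has_derivative_fst[OF has_derivative_snd[OF has_derivative_ident]]
        has_derivative_snd[OF has_derivative_snd[OF has_derivative_ident]], of \<mu> y]
    by (simp add: case_prod_beta')
  show "(DH \<mu> has_derivative D2H \<mu> z) (at z)"
    using has_derivative_DH_fixed[OF has_derivative_ident] .
qed

lemma F_vec: "F_mat S \<theta> x u t *v h = Df (x t, u t, \<theta>) (\<iota>x h)"
  and G_vec: "G_mat S \<theta> x u t *v w = Df (x t, u t, \<theta>) (\<iota>u w)"
  and E_vec: "E_mat S \<theta> x u t *v k = Df (x t, u t, \<theta>) (0, 0, k)"
  unfolding F_mat_def G_mat_def E_mat_def
  using jacobian_vector[OF has_derivative_dyn[OF has_derivative_ident has_derivative_const has_derivative_const]]
    jacobian_vector[OF has_derivative_dyn[OF has_derivative_const has_derivative_ident has_derivative_const]]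
    jacobian_vector[OF has_derivative_dyn[OF has_derivative_const has_derivative_const has_derivative_ident]]
  by simp_all

lemma gradient_hamiltonian:
  "gradient (\<lambda>z. hamiltonian S \<mu> z u \<theta>) x = partial_gradient \<iota>x (DH \<mu> (x, u, \<theta>))"
  "gradient (\<lambda>w. hamiltonian S \<mu> x w \<theta>) u = partial_gradient \<iota>u (DH \<mu> (x, u, \<theta>))"
  by (rule gradient_eq_partial_gradient
      has_derivative_hamiltonian[OF has_derivative_ident has_derivative_const has_derivative_const]
      has_derivative_hamiltonian[OF has_derivative_const has_derivative_ident has_derivative_const])+

lemma gradient_fcost: "gradient (\<lambda>z. fcost S z \<theta>) x = partial_gradient \<iota>T (Dh (x, \<theta>))"
  by (rule gradient_eq_partial_gradient
      has_derivative_fcost[OF has_derivative_ident has_derivative_const])+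

lemma has_derivative_embeddings:
  "((\<lambda>z. (z, u, \<theta>)) has_derivative \<iota>x) (at x)"
  "((\<lambda>w. (x, w, \<theta>)) has_derivative \<iota>u) (at u)"
  "((\<lambda>\<eta>. (x, u, \<eta>)) has_derivative (\<lambda>k. (0, 0, k))) (at \<theta>)"
  "((\<lambda>z. (z, \<theta>)) has_derivative \<iota>T) (at x)"
  "((\<lambda>\<eta>. (x, \<eta>)) has_derivative (\<lambda>k. (0, k))) (at \<theta>)"
  for x :: "real^'n" and u :: "real^'m" and \<theta> :: "real^'p"
  by (rule has_derivative_Pair has_derivative_ident has_derivative_const)+

lemma hessian_vec:
  fixes \<theta> x u t
  defines "\<mu> \<equiv> costate S \<theta> x u (Suc t)" and "z \<equiv> (x t, u t, \<theta>)"
  shows "Hxx S \<theta> x u t *v h = partial_gradient \<iota>x (D2H \<mu> z (\<iota>x h))"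
    and "Huu S \<theta> x u t *v w = partial_gradient \<iota>u (D2H \<mu> z (\<iota>u w))"
    and "Hux S \<theta> x u t *v h = partial_gradient \<iota>u (D2H \<mu> z (\<iota>x h))"
    and "Hxth S \<theta> x u t *v k = partial_gradient \<iota>x (D2H \<mu> z (0, 0, k))"
    and "Huth S \<theta> x u t *v k = partial_gradient \<iota>u (D2H \<mu> z (0, 0, k))"
proof -
  note ext_x = ext[of "gradient _", OF gradient_hamiltonian(1)]
    and ext_u = ext[of "gradient _", OF gradient_hamiltonian(2)]
  note J = has_derivative_DH_fixed[OF has_derivative_embeddings(1), THEN jacobian_partial_gradient]
    has_derivative_DH_fixed[OF has_derivative_embeddings(2), THEN jacobian_partial_gradient]
    has_derivative_DH_fixed[OF has_derivative_embeddings(3), THEN jacobian_partial_gradient]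
  show "Hxx S \<theta> x u t *v h = partial_gradient \<iota>x (D2H \<mu> z (\<iota>x h))"
    unfolding Hxx_def ext_x \<mu>_def z_def by (rule J)
  show "Huu S \<theta> x u t *v w = partial_gradient \<iota>u (D2H \<mu> z (\<iota>u w))"
    unfolding Huu_def ext_u \<mu>_def z_def by (rule J)
  show "Hux S \<theta> x u t *v h = partial_gradient \<iota>u (D2H \<mu> z (\<iota>x h))"
    unfolding Hux_def gradient_hamiltonian \<mu>_def z_def by (rule J)
  show "Hxth S \<theta> x u t *v k = partial_gradient \<iota>x (D2H \<mu> z (0, 0, k))"
    unfolding Hxth_def gradient_hamiltonian \<mu>_def z_def by (rule J)
  show "Huth S \<theta> x u t *v k = partial_gradient \<iota>u (D2H \<mu> z (0, 0, k))"
    unfolding Huth_def gradient_hamiltonian \<mu>_def z_def by (rule J)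
qed

lemma terminal_hessian_vec:
  "HTxx S \<theta> x *v h = partial_gradient \<iota>T (D2h (x (horizon S), \<theta>) (\<iota>T h))"
  "HTxth S \<theta> x *v k = partial_gradient \<iota>T (D2h (x (horizon S), \<theta>) (0, k))"
proof -
  note J = has_derivative_compose[OF has_derivative_embeddings(4) Dh, THEN jacobian_partial_gradient]
    has_derivative_compose[OF has_derivative_embeddings(5) Dh, THEN jacobian_partial_gradient]
  show "HTxx S \<theta> x *v h = partial_gradient \<iota>T (D2h (x (horizon S), \<theta>) (\<iota>T h))"
    unfolding HTxx_def ext[of "gradient _", OF gradient_fcost] by (rule J)
  show "HTxth S \<theta> x *v k = partial_gradient \<iota>T (D2h (x (horizon S), \<theta>) (0, k))"
    unfolding HTxth_def gradient_fcost by (rule J)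
qed

text \<open>\<open>Hxu\<close> is defined by transposition; that it is also the derivative of the state gradient in the
  direction of the input is the symmetry of the second derivative.\<close>

lemma Hxu_vec:
  "Hxu S \<theta> x u t *v w =
     partial_gradient \<iota>x (D2H (costate S \<theta> x u (Suc t)) (x t, u t, \<theta>) (\<iota>u w))"
proof (rule vector_eq_ldot[THEN iffD1], intro allI)
  fix k
  have "k \<bullet> (Hxu S \<theta> x u t *v w) = w \<bullet> (Hux S \<theta> x u t *v k)"
    unfolding Hxu_def by (metis inner_commute inner_matrix_vector)
  then show "k \<bullet> (Hxu S \<theta> x u t *v w) = k \<bullet>
      partial_gradient \<iota>x (D2H (costate S \<theta> x u (Suc t)) (x t, u t, \<theta>) (\<iota>u w))"
    by (simp add: hessian_vec inner_partial_gradient linear_embeddings D2H_symmetric[of _ _ "\<iota>x k"])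
qed

lemma Huu_symmetric: "transpose (Huu S \<theta> x u t) = Huu S \<theta> x u t"
proof (rule transpose_eq_selfI)
  fix v w
  show "v \<bullet> (Huu S \<theta> x u t *v w) = (Huu S \<theta> x u t *v v) \<bullet> w"
    unfolding inner_commute[of _ w]
    by (simp add: hessian_vec inner_partial_gradient linear_embeddings D2H_symmetric[of _ _ "\<iota>u w"])
qed

lemma costate_eq:
  "t < horizon S \<Longrightarrow> costate S \<theta> x u t =
     partial_gradient \<iota>x (DH (costate S \<theta> x u (Suc t)) (x t, u t, \<theta>))"
  "costate S \<theta> x u (horizon S) = partial_gradient \<iota>T (Dh (x (horizon S), \<theta>))"
proof -
  assume t: "t < horizon S"
  have g: "gradient (\<lambda>z. rcost S z (u t) \<theta>) (x t) = partial_gradient \<iota>x (Dc (x t, u t, \<theta>))"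
    by (rule gradient_eq_partial_gradient
        has_derivative_rcost[OF has_derivative_ident has_derivative_const has_derivative_const])+
  show "costate S \<theta> x u t = partial_gradient \<iota>x (DH (costate S \<theta> x u (Suc t)) (x t, u t, \<theta>))"
  proof (rule vector_eq_ldot[THEN iffD1], intro allI)
    fix k
    let ?\<mu> = "costate S \<theta> x u (Suc t)"
    have "k \<bullet> (transpose (F_mat S \<theta> x u t) *v ?\<mu>) = Df (x t, u t, \<theta>) (\<iota>x k) \<bullet> ?\<mu>"
      by (metis F_vec inner_matrix_vector transpose_transpose)
    then show "k \<bullet> costate S \<theta> x u t = k \<bullet> partial_gradient \<iota>x (DH ?\<mu> (x t, u t, \<theta>))"
      using t by (subst costate.simps)
        (simp add: g inner_add_right inner_partial_gradient linear_embeddings DH_apply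
          del: transpose_matrix_vector)
  qed
next
  show "costate S \<theta> x u (horizon S) = partial_gradient \<iota>T (Dh (x (horizon S), \<theta>))"
    by (subst costate.simps) (simp add: gradient_fcost)
qed

end

section \<open>The maximum principle\<close>

primrec rollout ::
    "('n::finite, 'm::finite, 'p::finite) ocs \<Rightarrow> real^'p \<Rightarrow> (nat \<Rightarrow> real^'m) \<Rightarrow> nat \<Rightarrow> real^'n" where
  "rollout S \<theta> u 0 = init S"
| "rollout S \<theta> u (Suc t) = dyn S (rollout S \<theta> u t) (u t) \<theta>"

lemma feasible_rollout: "feasible S \<theta> (rollout S \<theta> u) u"
  by (simp add: feasible_def)

lemma feasible_eq_rollout:
  assumes "feasible S \<theta> x u" "t \<le> horizon S"
  shows "x t = rollout S \<theta> u t"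
  using assms(2) by (induction t) (use assms(1) in \<open>auto simp: feasible_def\<close>)

context differentiated_ocs
begin

text \<open>Push all inputs simultaneously along \<open>s p\<close>, where \<open>p k\<close> is the input gradient of the Hamiltonian
  at time \<open>k\<close>, and let the states follow the dynamics. The costates make the first variation of the
  cost telescope to \<open>\<Sum>k. |p k|\<^sup>2\<close>, which vanishes at a minimizer.\<close>

lemma minimizer_stationary:
  assumes min: "minimizer S \<theta> x u" and t: "t < horizon S"
  shows "partial_gradient \<iota>u (DH (costate S \<theta> x u (Suc t)) (x t, u t, \<theta>)) = 0"
proof -
  define z where "z k = (x k, u k, \<theta>)" for k
  define p where "p k = partial_gradient \<iota>u (DH (costate S \<theta> x u (Suc k)) (z k))" for k
  define v where "v s k = u k + s *\<^sub>R p k" for s :: real and k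
  define y where "y s = rollout S \<theta> (v s)" for s
  define \<delta> where "\<delta> = rec_nat 0 (\<lambda>k d. blinfun_apply (Df (z k)) (d, p k, 0))"
  have \<delta>: "\<delta> 0 = 0" "\<delta> (Suc k) = Df (z k) (\<delta> k, p k, 0)" for k
    by (simp_all add: \<delta>_def)
  have v0: "v 0 = u" by (simp add: v_def fun_eq_iff)
  have y0: "y 0 k = x k" if "k \<le> horizon S" for k
    using feasible_eq_rollout[of S \<theta> x u k] min that by (simp add: minimizer_def y_def v0)
  have v': "((\<lambda>s. v s k) has_derivative (\<lambda>h. h *\<^sub>R p k)) (at 0)" for k
    unfolding v_def by (auto intro!: derivative_eq_intros)
  have scale: "(\<lambda>h. blinfun_apply B (h *\<^sub>R d, h *\<^sub>R w, 0)) = (\<lambda>h. h *\<^sub>R blinfun_apply B (d, w, 0))"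
    for B :: "((real^'n) \<times> (real^'m) \<times> (real^'p)) \<Rightarrow>\<^sub>L 'z::real_normed_vector" and d w
    by (simp add: fun_eq_iff flip: blinfun.scaleR_right)
  have y': "((\<lambda>s. y s k) has_derivative (\<lambda>h. h *\<^sub>R \<delta> k)) (at 0)" if "k \<le> horizon S" for k
    using that
  proof (induction k)
    case 0
    then show ?case by (simp add: y_def \<delta>)
  next
    case (Suc k)
    then have k: "k \<le> horizon S" by simp
    have "((\<lambda>s. dyn S (y s k) (v s k) \<theta>) has_derivative
        (\<lambda>h. Df (y 0 k, v 0 k, \<theta>) (h *\<^sub>R \<delta> k, h *\<^sub>R p k, 0))) (at 0)"
      using has_derivative_dyn[OF Suc.IH[OF k] v' has_derivative_const[where c = \<theta>]] .
    moreover have "(\<lambda>s. y s (Suc k)) = (\<lambda>s. dyn S (y s k) (v s k) \<theta>)"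
      by (simp add: y_def)
    ultimately show ?case
      by (simp only: scale y0[OF k] v0 \<delta> z_def)
  qed
  have "((\<lambda>s. total_cost S \<theta> (y s) (v s)) has_derivative
      (\<lambda>h. (\<Sum>k<horizon S. h *\<^sub>R Dc (z k) (\<delta> k, p k, 0)) + h *\<^sub>R Dh (x (horizon S), \<theta>) (\<delta> (horizon S), 0))) (at 0)"
    unfolding total_cost_def
  proof (intro has_derivative_add has_derivative_sum)
    fix k assume k: "k \<in> {..<horizon S}"
    then show "((\<lambda>s. rcost S (y s k) (v s k) \<theta>) has_derivative (\<lambda>h. h *\<^sub>R Dc (z k) (\<delta> k, p k, 0))) (at 0)"
      using has_derivative_rcost[OF y' v' has_derivative_const[where c = \<theta>], of k k]
      by (simp only: scale) (simp add: y0 v_def z_def)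
  next
    have "((\<lambda>s. fcost S (y s (horizon S)) \<theta>) has_derivative
        (\<lambda>h. Dh (x (horizon S), \<theta>) (h *\<^sub>R \<delta> (horizon S), 0))) (at 0)"
      using has_derivative_fcost[OF y'[OF order_refl] has_derivative_const[where c = \<theta>]] by (simp add: y0)
    moreover have "(\<lambda>h. Dh (x (horizon S), \<theta>) (h *\<^sub>R \<delta> (horizon S), 0)) =
        (\<lambda>h. h *\<^sub>R Dh (x (horizon S), \<theta>) (\<delta> (horizon S), 0))"
      by (rule ext) (metis blinfun.scaleR_right scaleR_Pair scaleR_zero_right)
    ultimately show "((\<lambda>s. fcost S (y s (horizon S)) \<theta>) has_derivative
        (\<lambda>h. h *\<^sub>R Dh (x (horizon S), \<theta>) (\<delta> (horizon S), 0))) (at 0)" by metis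
  qed
  moreover have "total_cost S \<theta> (y 0) (v 0) \<le> total_cost S \<theta> (y s) (v s)" for s
  proof -
    have "total_cost S \<theta> (y 0) (v 0) = total_cost S \<theta> x u"
      by (simp add: total_cost_def y0 v_def)
    also have "\<dots> \<le> total_cost S \<theta> (y s) (v s)"
      using min feasible_rollout unfolding minimizer_def y_def by blast
    finally show ?thesis .
  qed
  ultimately have "(\<lambda>h. (\<Sum>k<horizon S. h *\<^sub>R Dc (z k) (\<delta> k, p k, 0)) +
      h *\<^sub>R Dh (x (horizon S), \<theta>) (\<delta> (horizon S), 0)) = (\<lambda>h. 0)"
    by (intro has_derivative_local_min) auto
  from fun_cong[OF this, of 1]
  have zero: "(\<Sum>k<horizon S. Dc (z k) (\<delta> k, p k, 0)) + Dh (x (horizon S), \<theta>) (\<delta> (horizon S), 0) = 0"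
    by simp
  let ?\<mu> = "costate S \<theta> x u"
  \<comment> \<open>The adjoint identity: the term \<open>\<delta> j \<bullet> ?\<mu> j\<close> carries the effect of the first \<open>j\<close> perturbations on
    the remaining cost. It starts at \<open>0\<close> and ends as the variation of the final cost.\<close>
  have "(\<Sum>k<j. Dc (z k) (\<delta> k, p k, 0)) + \<delta> j \<bullet> ?\<mu> j = (\<Sum>k<j. p k \<bullet> p k)" if "j \<le> horizon S" for j
    using that
  proof (induction j)
    case 0
    then show ?case by (simp add: \<delta>)
  next
    case (Suc j)
    have 1: "\<delta> j \<bullet> ?\<mu> j = DH (?\<mu> (Suc j)) (z j) (\<iota>x (\<delta> j))"
      using Suc.prems by (simp add: costate_eq inner_partial_gradient linear_embeddings z_def)
    have 2: "p j \<bullet> p j = DH (?\<mu> (Suc j)) (z j) (\<iota>u (p j))"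
      using inner_partial_gradient[OF linear_embeddings(2), of "p j" "DH (?\<mu> (Suc j)) (z j)", folded p_def] .
    have "DH (?\<mu> (Suc j)) (z j) (\<iota>x (\<delta> j)) + DH (?\<mu> (Suc j)) (z j) (\<iota>u (p j)) =
        DH (?\<mu> (Suc j)) (z j) (\<delta> j, p j, 0)"
      by (simp flip: blinfun.add_right)
    also have "\<dots> = Dc (z j) (\<delta> j, p j, 0) + \<delta> (Suc j) \<bullet> ?\<mu> (Suc j)"
      by (simp add: DH_apply \<delta>)
    finally show ?case using Suc 1 2 by simp
  qed
  from this[OF order_refl] have "(\<Sum>k<horizon S. p k \<bullet> p k) = 0"
    using zero by (simp add: costate_eq inner_partial_gradient linear_embeddings)
  then have "p t = 0" using t by (simp add: sum_nonneg_eq_0_iff)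
  then show ?thesis by (simp add: p_def z_def)
qed

end

section \<open>Correctness of the gradient generator\<close>

text \<open>One step of the backward pass as linear algebra. Here \<open>a\<close>, \<open>b\<close> and \<open>y\<close> are the derivatives of the state,
  the input and the next costate in the direction \<open>h\<close>. Stationarity gives \<open>b\<close> in terms of \<open>y\<close>;
  inserting it into \<open>y = V x + W h\<close> at the next state leaves \<open>(I + V B) y = V (A a + M h) + W h\<close>.
  Eliminating \<open>b\<close> from the costate recursion then produces the matrices \<open>C\<close>, \<open>N\<close> and \<open>A'\<close>.\<close>

lemma riccati_step:
  fixes F :: "real^'n^'n" and G :: "real^'m^'n" and E :: "real^'p^'n"
    and Hxx :: "real^'n^'n" and Hux :: "real^'n^'m" and Huu :: "real^'m^'m"
    and Hxth :: "real^'p^'n" and Huth :: "real^'p^'m" and V :: "real^'n^'n" and W :: "real^'p^'n"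
  defines "Hi \<equiv> matrix_inv Huu"
  defines "A \<equiv> F - G ** Hi ** Hux" and "B \<equiv> G ** Hi ** transpose G"
    and "M \<equiv> E - G ** Hi ** Huth"
    and "C \<equiv> Hxx - transpose Hux ** Hi ** Hux" and "N \<equiv> Hxth - transpose Hux ** Hi ** Huth"
  assumes inv: "invertible Huu" "invertible (mat 1 + V ** B)" and sym: "transpose Huu = Huu"
    and stationary: "Hux *v a + Huu *v b + Huth *v h + transpose G *v y = 0"
    and y: "y = V *v (F *v a + G *v b + E *v h) + W *v h"
  shows "b = - (Hi *v (Hux *v a + Huth *v h + transpose G *v y))"
    and "y = matrix_inv (mat 1 + V ** B) *v (V *v (A *v a) + V *v (M *v h) + W *v h)"
    and "Hxx *v a + transpose Hux *v b + Hxth *v h + transpose F *v y =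
         C *v a + N *v h + transpose A *v y"
proof -
  note Hi = matrix_inv_right_vector[OF inv(1), folded Hi_def] matrix_inv_left_vector[OF inv(1), folded Hi_def]
  have "Huu *v b = - (Hux *v a + Huth *v h + transpose G *v y)"
    using stationary by (simp add: algebra_simps eq_neg_iff_add_eq_0 del: transpose_matrix_vector)
  then have "b = Hi *v (- (Hux *v a + Huth *v h + transpose G *v y))"
    using Hi(2)[of b] by simp
  then show b: "b = - (Hi *v (Hux *v a + Huth *v h + transpose G *v y))"
    by (simp only: linear_neg[OF matrix_vector_mul_linear])
  note vec = matrix_vector_mult_add_rdistrib matrix_vector_mult_diff_rdistrib
    matrix_vector_right_distrib matrix_vector_mult_diff_distrib
    linear_neg[OF matrix_vector_mul_linear] matrix_vector_mul_assoc[symmetric]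
  have y2: "y = V *v (F *v a) + V *v (G *v b) + V *v (E *v h) + W *v h"
    using y by (simp add: vec)
  have "(mat 1 + V ** B) *v y = y + V *v (G *v (Hi *v (transpose G *v y)))"
    by (simp add: vec B_def del: transpose_matrix_vector)
  also have "\<dots> = V *v (F *v a) + V *v (G *v b) + V *v (E *v h) + W *v h
      + V *v (G *v (Hi *v (transpose G *v y)))"
    by (simp only: y2[symmetric])
  also have "V *v (G *v b) = - (V *v (G *v (Hi *v (Hux *v a))) + V *v (G *v (Hi *v (Huth *v h)))
      + V *v (G *v (Hi *v (transpose G *v y))))"
    by (simp add: b vec del: transpose_matrix_vector)
  finally have "(mat 1 + V ** B) *v y = V *v (A *v a) + V *v (M *v h) + W *v h"
    by (simp add: vec A_def M_def del: transpose_matrix_vector)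
  then show "y = matrix_inv (mat 1 + V ** B) *v (V *v (A *v a) + V *v (M *v h) + W *v h)"
    using matrix_inv_left_vector[OF inv(2), of y] by simp
  have Hisym: "transpose Hi = Hi"
  proof (rule transpose_eq_selfI)
    fix v w
    show "v \<bullet> (Hi *v w) = (Hi *v v) \<bullet> w"
      using inner_matrix_vector[of "Hi *v v" Huu "Hi *v w"] by (simp only: sym Hi)
  qed
  have "transpose A *v y = transpose F *v y - transpose Hux *v (Hi *v (transpose G *v y))"
  proof (rule inner_left_eqI)
    fix k
    have "v \<bullet> (Hi *v w) = (Hi *v v) \<bullet> w" for v w
      using inner_matrix_vector[of v Hi w] by (simp only: Hisym)
    then show "k \<bullet> (transpose A *v y) =
        k \<bullet> (transpose F *v y - transpose Hux *v (Hi *v (transpose G *v y)))"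
      by (simp only: inner_transpose_vector inner_diff_right A_def vec inner_diff_left)
  qed
  then show "Hxx *v a + transpose Hux *v b + Hxth *v h + transpose F *v y =
         C *v a + N *v h + transpose A *v y"
    by (simp add: b vec C_def N_def del: transpose_matrix_vector)
qed

context differentiated_ocs
begin

text \<open>Differentiability of the optimal states and inputs is given, that of the costates is not. It is
  obtained in the same backward induction that identifies their derivative as \<open>V X + W\<close>, starting from
  the final cost. A forward induction then matches the true derivatives with the generator output.\<close>

lemma generator_correct:
  fixes xs :: "real^'p \<Rightarrow> nat \<Rightarrow> real^'n" and us :: "real^'p \<Rightarrow> nat \<Rightarrow> real^'m"
  assumes min: "\<And>\<theta>. minimizer S \<theta> (xs \<theta>) (us \<theta>)"
    and wp: "generator_wellposed S \<theta> (xs \<theta>) (us \<theta>)"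
    and xd: "\<And>t. t \<le> horizon S \<Longrightarrow> (\<lambda>\<eta>. xs \<eta> t) differentiable (at \<theta>)"
    and ud: "\<And>t. t < horizon S \<Longrightarrow> (\<lambda>\<eta>. us \<eta> t) differentiable (at \<theta>)"
  shows "t \<le> horizon S \<Longrightarrow>
          ((\<lambda>\<eta>. xs \<eta> t) has_derivative (\<lambda>h. X_mat S \<theta> (xs \<theta>) (us \<theta>) t *v h)) (at \<theta>)"
    and "t < horizon S \<Longrightarrow>
          ((\<lambda>\<eta>. us \<eta> t) has_derivative (\<lambda>h. U_mat S \<theta> (xs \<theta>) (us \<theta>) t *v h)) (at \<theta>)"
proof -
  define x u where "x = xs \<theta>" and "u = us \<theta>"
  define z where "z t = (x t, u t, \<theta>)" for t
  define \<mu> where "\<mu> \<eta> = costate S \<eta> (xs \<eta>) (us \<eta>)" for \<eta>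
  define X' where "X' t = frechet_derivative (\<lambda>\<eta>. xs \<eta> t) (at \<theta>)" for t
  define U' where "U' t = frechet_derivative (\<lambda>\<eta>. us \<eta> t) (at \<theta>)" for t
  have X': "((\<lambda>\<eta>. xs \<eta> t) has_derivative X' t) (at \<theta>)" if "t \<le> horizon S" for t
    using xd[OF that] by (simp add: X'_def frechet_derivative_works)
  have U': "((\<lambda>\<eta>. us \<eta> t) has_derivative U' t) (at \<theta>)" if "t < horizon S" for t
    using ud[OF that] by (simp add: U'_def frechet_derivative_works)
  define V where "V = V_mat S \<theta> x u"
  define W where "W = W_mat S \<theta> x u"
  have decomp: "(a, b, h) = \<iota>x a + \<iota>u b + (0, 0, h)" for a :: "real^'n" and b :: "real^'m" and h :: "real^'p"
    by simp
  have z': "((\<lambda>\<eta>. (xs \<eta> t, us \<eta> t, \<eta>)) has_derivative (\<lambda>h. (X' t h, U' t h, h))) (at \<theta>)"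
    if "t < horizon S" for t
    using that by (intro has_derivative_Pair X' U' has_derivative_ident) auto
  have step_x: "X' (Suc t) h = F_mat S \<theta> x u t *v X' t h + G_mat S \<theta> x u t *v U' t h + E_mat S \<theta> x u t *v h"
    if t: "t < horizon S" for t h
  proof -
    have "(\<lambda>\<eta>. xs \<eta> (Suc t)) = (\<lambda>\<eta>. dyn S (xs \<eta> t) (us \<eta> t) \<eta>)"
      using min t by (auto simp: minimizer_def feasible_def)
    moreover have "((\<lambda>\<eta>. dyn S (xs \<eta> t) (us \<eta> t) \<eta>) has_derivative
        (\<lambda>h. Df (x t, u t, \<theta>) (X' t h, U' t h, h))) (at \<theta>)"
      using has_derivative_dyn[OF X' U' has_derivative_ident] t by (simp add: x_def u_def)
    ultimately have "((\<lambda>\<eta>. xs \<eta> (Suc t)) has_derivative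
        (\<lambda>h. Df (x t, u t, \<theta>) (X' t h, U' t h, h))) (at \<theta>)"
      by simp
    then have "X' (Suc t) = (\<lambda>h. Df (x t, u t, \<theta>) (X' t h, U' t h, h))"
      using t by (intro has_derivative_unique[OF X']) auto
    then have "X' (Suc t) h = Df (x t, u t, \<theta>) (X' t h, U' t h, h)" by simp
    also have "\<dots> = Df (x t, u t, \<theta>) (\<iota>x (X' t h)) + Df (x t, u t, \<theta>) (\<iota>u (U' t h)) + Df (x t, u t, \<theta>) (0, 0, h)"
      by (subst decomp[of "X' t h" "U' t h" h]) (simp only: blinfun.add_right)
    finally show ?thesis by (simp only: F_vec G_vec E_vec)
  qed
  have backward: "((\<lambda>\<eta>. \<mu> \<eta> t) has_derivative (\<lambda>h. V t *v X' t h + W t *v h)) (at \<theta>) \<and>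
      (t < horizon S \<longrightarrow> (\<forall>h. U' t h = - (matrix_inv (Huu S \<theta> x u t) *v
         (Hux S \<theta> x u t *v X' t h + Huth S \<theta> x u t *v h + transpose (G_mat S \<theta> x u t) *v
           (matrix_inv (mat 1 + V (Suc t) ** B_mat S \<theta> x u t) *v
             (V (Suc t) *v (A_mat S \<theta> x u t *v X' t h) + V (Suc t) *v (M_mat S \<theta> x u t *v h)
               + W (Suc t) *v h))))))"
    if "t \<le> horizon S" for t
    using that
  proof (induction t rule: inc_induct)
    case base
    have "((\<lambda>\<eta>. partial_gradient \<iota>T (Dh (xs \<eta> (horizon S), \<eta>))) has_derivative
        (\<lambda>h. partial_gradient \<iota>T (D2h (x (horizon S), \<theta>) (X' (horizon S) h, h)))) (at \<theta>)"
      using bounded_linear.has_derivative[OF bounded_linear_partial_gradient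
          has_derivative_compose[OF has_derivative_Pair[OF X'[OF order_refl] has_derivative_ident] Dh]]
      by (simp add: x_def)
    moreover have "partial_gradient \<iota>T (D2h (x (horizon S), \<theta>) (a, h)) =
        HTxx S \<theta> x *v a + HTxth S \<theta> x *v h" for a h
    proof -
      have "D2h (x (horizon S), \<theta>) (a, h) = D2h (x (horizon S), \<theta>) (\<iota>T a) + D2h (x (horizon S), \<theta>) (0, h)"
        using linear_add[OF has_derivative_linear[OF Dh], of _ "\<iota>T a" "(0, h)"] by simp
      then show ?thesis
        by (simp only: terminal_hessian_vec
            linear_add[OF bounded_linear.linear[OF bounded_linear_partial_gradient]])
    qed
    ultimately show ?case
      by (simp add: \<mu>_def costate_eq V_def W_def V_mat.simps[of S \<theta> x u "horizon S"]
          W_mat.simps[of S \<theta> x u "horizon S"])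
  next
    case (step t)
    then have t: "t < horizon S" by simp
    define y where "y h = V (Suc t) *v X' (Suc t) h + W (Suc t) *v h" for h
    define m where "m = costate S \<theta> x u (Suc t)"
    have y': "((\<lambda>\<eta>. \<mu> \<eta> (Suc t)) has_derivative y) (at \<theta>)"
      using step.IH by (simp add: y_def[abs_def])
    have DH': "((\<lambda>\<eta>. DH (\<mu> \<eta> (Suc t)) (xs \<eta> t, us \<eta> t, \<eta>)) has_derivative
        (\<lambda>h. D2H m (z t) (X' t h, U' t h, h) + (blinfun_inner_left (y h) o\<^sub>L Df (z t)))) (at \<theta>)"
      using has_derivative_DH[OF y' z'[OF t]] by (simp add: m_def z_def x_def u_def \<mu>_def)
    have D2: "D2H m (z t) (X' t h, U' t h, h) =
        D2H m (z t) (\<iota>x (X' t h)) + D2H m (z t) (\<iota>u (U' t h)) + D2H m (z t) (0, 0, h)" for h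
      by (subst decomp[of "X' t h" "U' t h" h]) (simp only: linear_add[OF linear_D2H])
    note add = linear_add[OF bounded_linear.linear[OF bounded_linear_partial_gradient]]
    have FG: "partial_gradient \<iota>x (blinfun_inner_left v o\<^sub>L Df (z t)) = transpose (F_mat S \<theta> x u t) *v v"
      "partial_gradient \<iota>u (blinfun_inner_left v o\<^sub>L Df (z t)) = transpose (G_mat S \<theta> x u t) *v v" for v
      by (rule inner_left_eqI; simp add: inner_partial_gradient linear_embeddings
            blinfun_inner_left.rep_eq z_def inner_transpose_vector F_vec G_vec
            del: transpose_matrix_vector)+
    note hess = hessian_vec[of \<theta> x u t, folded m_def z_def[of t]]
      Hxu_vec[of \<theta> x u t, folded m_def z_def[of t]]
    have grad_x: "((\<lambda>\<eta>. \<mu> \<eta> t) has_derivative (\<lambda>h. Hxx S \<theta> x u t *v X' t h +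
        Hxu S \<theta> x u t *v U' t h + Hxth S \<theta> x u t *v h + transpose (F_mat S \<theta> x u t) *v y h)) (at \<theta>)"
    proof -
      have "(\<lambda>\<eta>. \<mu> \<eta> t) = (\<lambda>\<eta>. partial_gradient \<iota>x (DH (\<mu> \<eta> (Suc t)) (xs \<eta> t, us \<eta> t, \<eta>)))"
        by (simp add: \<mu>_def costate_eq(1)[OF t])
      then show ?thesis
        using bounded_linear.has_derivative[OF bounded_linear_partial_gradient DH', of \<iota>x]
        by (simp only: D2 add FG hess)
    qed
    \<comment> \<open>The Hamiltonian is stationary along the optimal trajectory of every parameter, so the input
      gradient is constantly \<open>0\<close> as a function of \<open>\<eta>\<close> and has derivative \<open>0\<close>.\<close>
    have stationary: "Hux S \<theta> x u t *v X' t h + Huu S \<theta> x u t *v U' t h + Huth S \<theta> x u t *v h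
        + transpose (G_mat S \<theta> x u t) *v y h = 0" for h
    proof -
      have "(\<lambda>\<eta>. partial_gradient \<iota>u (DH (\<mu> \<eta> (Suc t)) (xs \<eta> t, us \<eta> t, \<eta>))) = (\<lambda>\<eta>. 0)"
        using minimizer_stationary[OF min t] by (simp add: \<mu>_def)
      then have "((\<lambda>\<eta>. 0) has_derivative (\<lambda>h. partial_gradient \<iota>u
          (D2H m (z t) (X' t h, U' t h, h) + (blinfun_inner_left (y h) o\<^sub>L Df (z t))))) (at \<theta>)"
        using bounded_linear.has_derivative[OF bounded_linear_partial_gradient DH', of \<iota>u] by simp
      then have "(\<lambda>h. partial_gradient \<iota>u
          (D2H m (z t) (X' t h, U' t h, h) + (blinfun_inner_left (y h) o\<^sub>L Df (z t)))) = (\<lambda>h. 0)"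
        by (rule has_derivative_unique) (rule has_derivative_const)
      then have "partial_gradient \<iota>u
          (D2H m (z t) (X' t h, U' t h, h) + (blinfun_inner_left (y h) o\<^sub>L Df (z t))) = 0"
        by (rule fun_cong)
      then show ?thesis
        by (simp only: D2 add FG hess)
    qed
    have inv: "invertible (Huu S \<theta> x u t)" "invertible (mat 1 + V (Suc t) ** B_mat S \<theta> x u t)"
      using wp t by (simp_all add: generator_wellposed_def V_def x_def u_def)
    note hyps = inv[unfolded B_mat_def] Huu_symmetric stationary y_def[unfolded step_x[OF t]]
    note ric = riccati_step(1,2)[OF hyps, folded A_mat_def B_mat_def M_mat_def]
      riccati_step(3)[where Hxx = "Hxx S \<theta> x u t" and Hxth = "Hxth S \<theta> x u t", OF hyps,
        folded Hxu_def, folded A_mat_def C_mat_def N_mat_def]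
    have "Hxx S \<theta> x u t *v X' t h + Hxu S \<theta> x u t *v U' t h + Hxth S \<theta> x u t *v h
        + transpose (F_mat S \<theta> x u t) *v y h = V t *v X' t h + W t *v h" for h
    proof -
      note vec = matrix_vector_mult_add_rdistrib matrix_vector_right_distrib
        matrix_vector_mul_assoc[symmetric]
      have "V t = C_mat S \<theta> x u t + transpose (A_mat S \<theta> x u t)
             ** matrix_inv (mat 1 + V (Suc t) ** B_mat S \<theta> x u t) ** V (Suc t) ** A_mat S \<theta> x u t"
        "W t = transpose (A_mat S \<theta> x u t) ** matrix_inv (mat 1 + V (Suc t) ** B_mat S \<theta> x u t)
           ** (W (Suc t) + V (Suc t) ** M_mat S \<theta> x u t) + N_mat S \<theta> x u t"
        using t by (simp_all add: V_def W_def V_mat.simps[of S \<theta> x u t] W_mat.simps[of S \<theta> x u t])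
      then show ?thesis
        unfolding ric(3) by (subst ric(2)) (simp add: vec algebra_simps del: transpose_matrix_vector)
    qed
    then have "((\<lambda>\<eta>. \<mu> \<eta> t) has_derivative (\<lambda>h. V t *v X' t h + W t *v h)) (at \<theta>)"
      using grad_x by simp
    moreover have "U' t h = - (matrix_inv (Huu S \<theta> x u t) *v
         (Hux S \<theta> x u t *v X' t h + Huth S \<theta> x u t *v h + transpose (G_mat S \<theta> x u t) *v
           (matrix_inv (mat 1 + V (Suc t) ** B_mat S \<theta> x u t) *v
             (V (Suc t) *v (A_mat S \<theta> x u t *v X' t h) + V (Suc t) *v (M_mat S \<theta> x u t *v h)
               + W (Suc t) *v h))))" for h
      using ric(1)[of h] unfolding ric(2)[of h, symmetric] .
    ultimately show ?case by blast
  qed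
  have U_step: "U' t h = U_from_X S \<theta> x u t X *v h"
    if t: "t < horizon S" and X: "X' t h = X *v h" for t h X
  proof -
    note vec = matrix_vector_mult_add_rdistrib matrix_vector_right_distrib
      matrix_vector_mul_assoc[symmetric]
    have neg: "(- A) *v h = - (A *v h)" for A :: "real^'p^'m"
      using matrix_vector_mult_diff_rdistrib[of 0 A h] by simp
    show ?thesis
      using backward[of t] t unfolding U_from_X_def neg vec
      by (simp add: X V_def W_def del: transpose_matrix_vector)
  qed
  have X_eq: "X' t = (\<lambda>h. X_mat S \<theta> x u t *v h)" if "t \<le> horizon S" for t
    using that
  proof (induction t)
    case 0
    have "((\<lambda>\<eta>. xs \<eta> 0) has_derivative (\<lambda>h. 0)) (at \<theta>)"
      using min by (simp add: minimizer_def feasible_def)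
    then have "X' 0 = (\<lambda>h. 0)"
      by (rule has_derivative_unique[OF X'[OF le0]])
    then show ?case by simp
  next
    case (Suc t)
    then have t: "t < horizon S" "X' t = (\<lambda>h. X_mat S \<theta> x u t *v h)" by auto
    have "U' t h = U_from_X S \<theta> x u t (X_mat S \<theta> x u t) *v h" for h
      using t by (intro U_step) auto
    then show ?case
      by (simp add: fun_eq_iff step_x[OF t(1)] t(2) matrix_vector_mult_add_rdistrib
          flip: matrix_vector_mul_assoc)
  qed
  show "((\<lambda>\<eta>. xs \<eta> t) has_derivative (\<lambda>h. X_mat S \<theta> (xs \<theta>) (us \<theta>) t *v h)) (at \<theta>)"
    if "t \<le> horizon S" using X'[OF that] X_eq[OF that] by (simp add: x_def u_def)
  show "((\<lambda>\<eta>. us \<eta> t) has_derivative (\<lambda>h. U_mat S \<theta> (xs \<theta>) (us \<theta>) t *v h)) (at \<theta>)"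
    if t: "t < horizon S"
  proof -
    have "U' t = (\<lambda>h. U_mat S \<theta> x u t *v h)"
      using t U_step[OF t, of _ "X_mat S \<theta> x u t"] X_eq[of t] by (auto simp: U_mat_def)
    then show ?thesis using U'[OF t] by (simp add: x_def u_def)
  qed
qed

end

section \<open>Residuals along optimal trajectories\<close>

lemma twice_differentiableE:
  assumes "twice_differentiable g"
  obtains D D2 where "\<And>x. (g has_derivative blinfun_apply (D x)) (at x)"
    and "\<And>x. (D has_derivative D2 x) (at x)"
  using assms unfolding twice_differentiable_def differentiable_def by metis

lemma stack_rows_vector: "stack_rows X U *v h = stack_vec (X *v h) (U *v h)"
  by (simp add: vec_eq_iff stack_rows_def stack_vec_def matrix_vector_mult_def split: sum.split)

lemma bounded_linear_stack_vec: "bounded_linear (\<lambda>(x, u). stack_vec x u)"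
  by (simp add: linear_conv_bounded_linear[symmetric] linear_iff stack_vec_def vec_eq_iff
      split: sum.split)

lemma differentiable_unstack:
  fixes x :: "'a::real_normed_vector \<Rightarrow> real^'n" and u :: "'a \<Rightarrow> real^'m"
  assumes "(\<lambda>\<eta>. stack_vec (x \<eta>) (u \<eta>)) differentiable (at \<theta>)"
  shows "x differentiable (at \<theta>)" and "u differentiable (at \<theta>)"
proof -
  have "bounded_linear (\<lambda>w::real^('n + 'm). \<chi> i. w $ Inl i)"
    "bounded_linear (\<lambda>w::real^('n + 'm). \<chi> i. w $ Inr i)"
    by (simp_all add: linear_conv_bounded_linear[symmetric] linear_iff vec_eq_iff)
  then have "(\<lambda>\<eta>. \<chi> i. stack_vec (x \<eta>) (u \<eta>) $ Inl i) differentiable (at \<theta>)"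
    "(\<lambda>\<eta>. \<chi> i. stack_vec (x \<eta>) (u \<eta>) $ Inr i) differentiable (at \<theta>)"
    using assms by (auto simp: differentiable_def dest: bounded_linear.has_derivative)
  then show "x differentiable (at \<theta>)" and "u differentiable (at \<theta>)"
    by (simp_all add: stack_vec_def)
qed

lemma has_derivative_traj_slice:
  fixes S :: "('n::finite, 'm::finite, 'p::finite) ocs"
  assumes smooth: "smooth_ocs S" and min: "\<And>\<theta>. minimizer S \<theta> (xs \<theta>) (us \<theta>)"
    and diff: "\<And>t. t \<le> horizon S \<Longrightarrow> (\<lambda>\<theta>. traj_slice S (xs \<theta>) (us \<theta>) t) differentiable (at \<theta>)"
    and wp: "generator_wellposed S \<theta> (xs \<theta>) (us \<theta>)" and t: "t \<le> horizon S"
  shows "((\<lambda>\<theta>. traj_slice S (xs \<theta>) (us \<theta>) t) has_derivative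
           (\<lambda>h. slice_sens S \<theta> (xs \<theta>) (us \<theta>) t *v h)) (at \<theta>)"
proof -
  obtain Df D2f Dc D2c Dh D2h where "differentiated_ocs S Df D2f Dc D2c Dh D2h"
    using smooth unfolding smooth_ocs_def differentiated_ocs_def
    by (elim conjE twice_differentiableE) blast
  then interpret differentiated_ocs S Df D2f Dc D2c Dh D2h .
  have xd: "(\<lambda>\<eta>. xs \<eta> k) differentiable (at \<theta>)" if "k \<le> horizon S" for k
    using differentiable_unstack(1)[OF diff[OF that, unfolded traj_slice_def]] .
  have ud: "(\<lambda>\<eta>. us \<eta> k) differentiable (at \<theta>)" if "k < horizon S" for k
    using differentiable_unstack(2)[of "\<lambda>\<eta>. xs \<eta> k" "\<lambda>\<eta>. us \<eta> k" \<theta>] diff[of k] that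
    by (simp add: traj_slice_def)
  note gen = generator_correct[OF min wp xd ud]
  have "((\<lambda>\<eta>. if t < horizon S then us \<eta> t else 0) has_derivative
      (\<lambda>h. (if t < horizon S then U_mat S \<theta> (xs \<theta>) (us \<theta>) t else 0) *v h)) (at \<theta>)"
    using gen(2) by simp
  from bounded_linear.has_derivative[OF bounded_linear_stack_vec has_derivative_Pair[OF gen(1)[OF _ _ t] this]]
  show ?thesis by (simp add: traj_slice_def slice_sens_def stack_rows_vector)
qed

lemma has_derivative_traj_residual:
  fixes S :: "('n::finite, 'm::finite, 'p::finite) ocs"
  assumes hm: "twice_differentiable hm"
    and slice: "((\<lambda>\<theta>. traj_slice S (xs \<theta>) (us \<theta>) t) has_derivative
           (\<lambda>h. slice_sens S \<theta> (xs \<theta>) (us \<theta>) t *v h)) (at \<theta>)"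
  shows "(traj_residual S xs us hm obs t has_derivative
           (\<lambda>h. residual_jacobian S xs us hm obs t \<theta> *v h)) (at \<theta>)"
proof -
  obtain D D2 where D: "\<And>\<xi>. (hm has_derivative blinfun_apply (D \<xi>)) (at \<xi>)"
    and "\<And>\<xi>. (D has_derivative D2 \<xi>) (at \<xi>)"
    using twice_differentiableE[OF hm] by blast
  have r: "((\<lambda>\<xi>. residual hm \<xi> y) has_derivative (\<lambda>k. - D \<xi> k)) (at \<xi>)" for y \<xi>
    unfolding residual_def using has_derivative_diff[OF has_derivative_const[of y] D] by simp
  show ?thesis
    using has_derivative_compose[OF slice r, of "obs t"]
    by (simp add: traj_residual_def[abs_def] residual_jacobian_def jacobian_vector[OF r]
        flip: matrix_vector_mul_assoc)
qed

text \<open>The generator formula involves second derivatives, which need not be continuous. But its value is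
  the derivative of the trajectory slice, and derivatives are unique, so it inherits the continuity
  from the assumed continuous derivative.\<close>

lemma isCont_residual_jacobian:
  fixes S :: "('n::finite, 'm::finite, 'p::finite) ocs"
  assumes hm: "twice_differentiable hm"
    and C1: "continuously_differentiable (\<lambda>\<theta>. traj_slice S (xs \<theta>) (us \<theta>) t)"
    and slice: "\<And>\<theta>. ((\<lambda>\<theta>. traj_slice S (xs \<theta>) (us \<theta>) t) has_derivative
           (\<lambda>h. slice_sens S \<theta> (xs \<theta>) (us \<theta>) t *v h)) (at \<theta>)"
  shows "isCont (residual_jacobian S xs us hm obs t) \<theta>"
proof -
  let ?\<xi> = "\<lambda>\<theta>. traj_slice S (xs \<theta>) (us \<theta>) t"
  obtain D D2 where D: "\<And>\<xi>. (hm has_derivative blinfun_apply (D \<xi>)) (at \<xi>)"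
    and D2: "\<And>\<xi>. (D has_derivative D2 \<xi>) (at \<xi>)"
    using twice_differentiableE[OF hm] by blast
  obtain G where G: "\<And>\<theta>. (?\<xi> has_derivative blinfun_apply (G \<theta>)) (at \<theta>)" "continuous_on UNIV G"
    using C1 unfolding continuously_differentiable_def by blast
  have r: "((\<lambda>\<xi>. residual hm \<xi> y) has_derivative (\<lambda>k. - D \<xi> k)) (at \<xi>)" for y \<xi>
    unfolding residual_def using has_derivative_diff[OF has_derivative_const[of y] D] by simp
  have slice_G: "slice_sens S \<theta> (xs \<theta>) (us \<theta>) t *v h = G \<theta> h" for \<theta> h
    using fun_cong[OF has_derivative_unique[OF slice G(1)]] .
  have J: "residual_jacobian S xs us hm obs t \<theta> *v h = - D (?\<xi> \<theta>) (G \<theta> h)" for \<theta> h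
    by (simp add: residual_jacobian_def jacobian_vector[OF r] slice_G flip: matrix_vector_mul_assoc)
  have entry: "A $ i $ j = (A *v axis j 1) $ i" for A :: "real^'p^'c" and i j
    by (simp add: matrix_vector_mul_component inner_axis)
  have "isCont (\<lambda>\<theta>. D (?\<xi> \<theta>)) \<theta>"
    using isCont_o2[OF has_derivative_continuous[OF slice] has_derivative_continuous[OF D2]] .
  moreover have "isCont G \<theta>" using G(2) by (simp add: continuous_on_eq_continuous_at)
  ultimately have "((\<lambda>\<eta>. residual_jacobian S xs us hm obs t \<eta> $ i $ j) \<longlongrightarrow>
      residual_jacobian S xs us hm obs t \<theta> $ i $ j) (at \<theta>)" for i j
    unfolding entry J isCont_def
    by (intro tendsto_vec_nth tendsto_minus blinfun.tendsto tendsto_const)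
  then show ?thesis unfolding isCont_def by (intro vec_tendstoI)
qed

section \<open>One step of the filter in information form\<close>

text \<open>One step in information form, with \<open>Q\<close> the inverse of \<open>P\<close>. The gain satisfies \<open>Q K = L' S\<^sup>-\<^sup>1\<close> and
  \<open>L K e = e - R S\<^sup>-\<^sup>1 e\<close>; with these two relations the cross terms of the quadratic form cancel, and what
  remains is the exact balance of the last claim.\<close>

lemma ekf_update_information:
  fixes P Q :: "real^'p^'p" and L :: "real^'p^'r" and R :: "real^'r^'r"
  assumes Qsym: "transpose Q = Q" and PQ: "P ** Q = mat 1"
    and Qnn: "\<And>x. 0 \<le> x \<bullet> (Q *v x)"
    and Rsym: "transpose R = R" and \<rho>: "0 < \<rho>" "\<And>x. \<rho> * (norm x)\<^sup>2 \<le> x \<bullet> (R *v x)"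
  defines "Q' \<equiv> Q + transpose L ** matrix_inv R ** L"
    and "S \<equiv> L ** P ** transpose L + R" and "K \<equiv> kalman_gain P L R"
  shows "transpose Q' = Q'"
    and "x \<bullet> (Q *v x) \<le> x \<bullet> (Q' *v x)"
    and "\<rho> * (norm y)\<^sup>2 \<le> y \<bullet> (S *v y)"
    and "((mat 1 - K ** L) ** P) ** Q' = mat 1"
    and "(x - K *v e) \<bullet> (Q' *v (x - K *v e)) =
          x \<bullet> (Q *v x) + (L *v x - e) \<bullet> (matrix_inv R *v (L *v x - e)) - e \<bullet> (matrix_inv S *v e)"
proof -
  have QPv: "Q *v (P *v y) = y" for y
    using matrix_left_right_inverse1[OF PQ] by (simp add: matrix_vector_mul_assoc)
  have PQv: "P *v (Q *v y) = y" for y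
    using PQ by (simp add: matrix_vector_mul_assoc)
  note Rinv = coercive_invertible[OF \<rho>]
  note Ri = matrix_inv_right_vector[OF Rinv] matrix_inv_left_vector[OF Rinv]
  have Q'v: "Q' *v y = Q *v y + transpose L *v (matrix_inv R *v (L *v y))" for y
    by (simp add: Q'_def matrix_vector_mult_add_rdistrib flip: matrix_vector_mul_assoc)
  have Sv: "S *v y = L *v (P *v (transpose L *v y)) + R *v y" for y
    by (simp add: S_def matrix_vector_mult_add_rdistrib flip: matrix_vector_mul_assoc)
  have Kv: "K *v y = P *v (transpose L *v (matrix_inv S *v y))" for y
    by (simp add: K_def kalman_gain_def S_def flip: matrix_vector_mul_assoc)
  have Rsw: "x \<bullet> (R *v y) = (R *v x) \<bullet> y" for x y
    using inner_matrix_vector[of x R y] Rsym by (simp del: transpose_matrix_vector)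
  have Qsw: "x \<bullet> (Q *v y) = (Q *v x) \<bullet> y" for x y
    using inner_matrix_vector[of x Q y] Qsym by (simp del: transpose_matrix_vector)
  have Lsw: "x \<bullet> (transpose L *v y) = (L *v x) \<bullet> y" for x y
    by (metis inner_matrix_vector transpose_transpose)
  have Risw: "x \<bullet> (matrix_inv R *v y) = (matrix_inv R *v x) \<bullet> y" for x y
    using Rsw[of "matrix_inv R *v x" "matrix_inv R *v y"] by (simp add: Ri)
  show "transpose Q' = Q'"
    by (rule transpose_eq_selfI)
      (simp add: Q'v inner_add_left inner_add_right Qsw Lsw Risw
        flip: inner_matrix_vector del: transpose_matrix_vector)
  have Rinn: "0 \<le> y \<bullet> (matrix_inv R *v y)" for y
    using order_trans[OF _ \<rho>(2), of 0 "matrix_inv R *v y"] \<rho>(1)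
    by (simp add: Ri inner_commute)
  show "x \<bullet> (Q *v x) \<le> x \<bullet> (Q' *v x)"
    by (simp add: Q'v inner_add_right Lsw Rinn del: transpose_matrix_vector)
  have Pnn: "0 \<le> y \<bullet> (P *v y)" for y
    using Qnn[of "P *v y"] by (simp add: QPv inner_commute)
  have "y \<bullet> (S *v y) = (transpose L *v y) \<bullet> (P *v (transpose L *v y)) + y \<bullet> (R *v y)" for y
    by (simp only: Sv inner_add_right inner_matrix_vector[of y L])
  note yS = this
  have Scoer: "\<rho> * (norm y)\<^sup>2 \<le> y \<bullet> (S *v y)" for y
    using yS[of y] Pnn[of "transpose L *v y"] \<rho>(2)[of y] by linarith
  then show "\<rho> * (norm y)\<^sup>2 \<le> y \<bullet> (S *v y)" .
  note Sinv = coercive_invertible[OF \<rho>(1) Scoer]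
  note Si = matrix_inv_right_vector[OF Sinv] matrix_inv_left_vector[OF Sinv]
  have "((mat 1 - K ** L) ** P) ** Q' *v y = y" for y
  proof -
    define z where "z = matrix_inv R *v (L *v y)"
    have PQ'y: "P *v (Q' *v y) = y + P *v (transpose L *v z)"
      by (simp add: Q'v z_def matrix_vector_right_distrib PQv del: transpose_matrix_vector)
    have "L *v (P *v (Q' *v y)) = S *v z"
      by (simp add: PQ'y Sv matrix_vector_right_distrib del: transpose_matrix_vector)
        (simp add: z_def Ri)
    then have "K *v (L *v (P *v (Q' *v y))) = P *v (transpose L *v z)"
      by (simp add: Kv Si del: transpose_matrix_vector)
    then show ?thesis
      by (simp add: matrix_vector_mult_diff_rdistrib PQ'y flip: matrix_vector_mul_assoc)
  qed
  then show "((mat 1 - K ** L) ** P) ** Q' = mat 1"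
    by (simp add: matrix_eq)
  define w k d where "w = matrix_inv S *v e" and "k = K *v e" and "d = L *v x - e"
  have k: "k = P *v (transpose L *v w)"
    by (simp add: k_def w_def Kv)
  have e: "e = S *v w" by (simp add: w_def Si)
  have Lk: "L *v k = e - R *v w" by (simp add: k e Sv)
  have Qk: "Q *v k = transpose L *v w" by (simp add: k QPv)
  have "L *v (x - k) = d + R *v w"
    by (simp add: d_def Lk matrix_vector_mult_diff_distrib)
  then have "(L *v (x - k)) \<bullet> (matrix_inv R *v (L *v (x - k))) =
      d \<bullet> (matrix_inv R *v d) + 2 * (d \<bullet> w) + w \<bullet> (R *v w)"
    by (simp add: matrix_vector_right_distrib Ri inner_add_left inner_add_right Risw Rsw)
       (simp add: inner_commute)
  moreover have "(x - k) \<bullet> (Q *v (x - k)) =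
      x \<bullet> (Q *v x) - 2 * ((L *v x) \<bullet> w) + e \<bullet> w - w \<bullet> (R *v w)"
  proof -
    have "(Q *v x) \<bullet> k = (L *v x) \<bullet> w" "k \<bullet> (Q *v k) = e \<bullet> w - w \<bullet> (R *v w)" "x \<bullet> (Q *v k) = (L *v x) \<bullet> w"
      by (simp_all only: Qk Lsw Lk inner_diff_left flip: Qsw) (simp add: inner_commute)
    then show ?thesis
      by (simp add: matrix_vector_mult_diff_distrib inner_diff_left inner_diff_right)
         (metis inner_commute)
  qed
  ultimately show "(x - K *v e) \<bullet> (Q' *v (x - K *v e)) =
          x \<bullet> (Q *v x) + (L *v x - e) \<bullet> (matrix_inv R *v (L *v x - e)) - e \<bullet> (matrix_inv S *v e)"
    by (simp add: Q'v inner_add_right Lsw del: transpose_matrix_vector flip: k_def w_def d_def)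
       (simp add: d_def inner_diff_left)
qed

text \<open>The two terms of the exact balance are estimated separately: \<open>R\<^sup>-\<^sup>1\<close> is at most \<open>1 / \<rho>\<close>, which bounds the
  loss by nonlinearity, and \<open>S\<close> has norm at most \<open>s\<close>. With \<open>w = S\<^sup>-\<^sup>1 e\<close> the latter gives
  \<open>e \<bullet> w = w \<bullet> S w \<ge> \<rho> |w|\<^sup>2 \<ge> \<rho> (|e| / s)\<^sup>2\<close>.\<close>

lemma ekf_update_decrease:
  fixes P Q :: "real^'p^'p" and L :: "real^'p^'r" and R :: "real^'r^'r"
  assumes Qsym: "transpose Q = Q" and PQ: "P ** Q = mat 1"
    and q: "0 < q" "\<And>x. q * (norm x)\<^sup>2 \<le> x \<bullet> (Q *v x)"
    and Rsym: "transpose R = R" and \<rho>: "0 < \<rho>" "\<And>x. \<rho> * (norm x)\<^sup>2 \<le> x \<bullet> (R *v x)"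
    and \<sigma>: "\<And>x. norm (R *v x) \<le> \<sigma> * norm x"
    and b: "0 \<le> b" "\<And>x. norm (L *v x) \<le> b * norm x"
    and s: "b\<^sup>2 / q + \<sigma> \<le> s" "0 < s"
    and \<epsilon>: "norm (L *v x - e) \<le> \<epsilon> * norm x"
    and c: "0 \<le> c" "c * norm x \<le> norm e"
  defines "Q' \<equiv> Q + transpose L ** matrix_inv R ** L" and "K \<equiv> kalman_gain P L R"
  shows "(x - K *v e) \<bullet> (Q' *v (x - K *v e)) \<le>
          x \<bullet> (Q *v x) + (\<epsilon>\<^sup>2 / \<rho> - \<rho> * c\<^sup>2 / s\<^sup>2) * (norm x)\<^sup>2"
proof -
  have Qnn: "0 \<le> x \<bullet> (Q *v x)" for x
    using order_trans[OF _ q(2)] q(1) by simp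
  define S where "S = L ** P ** transpose L + R"
  define d where "d = L *v x - e"
  note info = ekf_update_information[OF Qsym PQ Qnn Rsym \<rho>, where L = L, folded S_def]
  note Rinv = coercive_invertible[OF \<rho>]
  note Ri = matrix_inv_right_vector[OF Rinv] matrix_inv_left_vector[OF Rinv]
  note Sinv = coercive_invertible[OF \<rho>(1) info(3)]
  note Si = matrix_inv_right_vector[OF Sinv] matrix_inv_left_vector[OF Sinv]
  have "d \<bullet> (matrix_inv R *v d) \<le> norm d * norm (matrix_inv R *v d)"
    by (rule norm_cauchy_schwarz)
  also have "\<dots> \<le> norm d * (norm d / \<rho>)"
    using norm_le_of_coercive[OF \<rho>, of "matrix_inv R *v d"] \<rho>(1)
    by (intro mult_left_mono) (simp_all add: Ri field_simps)
  also have "\<dots> = (norm d)\<^sup>2 / \<rho>" by (simp add: power2_eq_square)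
  also have "\<dots> \<le> (\<epsilon> * norm x)\<^sup>2 / \<rho>"
    using \<epsilon> \<rho>(1) by (intro divide_right_mono power_mono) (simp_all add: d_def)
  finally have 1: "d \<bullet> (matrix_inv R *v d) \<le> \<epsilon>\<^sup>2 / \<rho> * (norm x)\<^sup>2"
    by (simp add: power_mult_distrib)
  have QPv: "Q *v (P *v y) = y" for y
    using matrix_left_right_inverse1[OF PQ] by (simp add: matrix_vector_mul_assoc)
  have P: "norm (P *v y) \<le> norm y / q" for y
    using norm_le_of_coercive[OF q, of "P *v y"] q(1) by (simp add: QPv field_simps)
  define w where "w = matrix_inv S *v e"
  have "norm e = norm (S *v w)" by (simp add: w_def Si)
  also have "S *v w = L *v (P *v (transpose L *v w)) + R *v w"
    by (simp add: S_def matrix_vector_mult_add_rdistrib flip: matrix_vector_mul_assoc)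
  also have "norm \<dots> \<le> b * (norm (transpose L *v w) / q) + \<sigma> * norm w"
    by (intro norm_triangle_le add_mono \<sigma> order_trans[OF b(2)] mult_left_mono P b(1))
  also have "\<dots> \<le> b * ((b * norm w) / q) + \<sigma> * norm w"
    using q(1) by (intro add_right_mono mult_left_mono divide_right_mono transpose_vector_bound b) auto
  also have "\<dots> = (b\<^sup>2 / q + \<sigma>) * norm w" by (simp add: power2_eq_square algebra_simps)
  also have "\<dots> \<le> s * norm w" by (intro mult_right_mono s) simp
  finally have "c * norm x \<le> s * norm w" using c by linarith
  then have "c * norm x / s \<le> norm w" using s(2) by (simp add: field_simps)
  then have "\<rho> * (c * norm x / s)\<^sup>2 \<le> \<rho> * (norm w)\<^sup>2"
    using \<rho>(1) s(2) c by (intro mult_left_mono power_mono) auto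
  also have "\<dots> \<le> w \<bullet> (S *v w)" by (rule info)
  also have "\<dots> = e \<bullet> (matrix_inv S *v e)" by (simp add: w_def Si inner_commute)
  finally have 2: "\<rho> * c\<^sup>2 / s\<^sup>2 * (norm x)\<^sup>2 \<le> e \<bullet> (matrix_inv S *v e)"
    by (simp add: power_mult_distrib power_divide)
  show ?thesis
    unfolding Q'_def K_def info(5) using 1 2 by (simp add: d_def algebra_simps)
qed


section \<open>Local convergence of the filter\<close>

lemma finite_uniform_constant:
  fixes P :: "'a \<Rightarrow> real \<Rightarrow> bool"
  assumes "finite I" and "\<And>s. s \<in> I \<Longrightarrow> \<exists>c>0. P s c"
    and mono: "\<And>s c c'. P s c \<Longrightarrow> 0 < c' \<Longrightarrow> c' \<le> c \<Longrightarrow> P s c'"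
  obtains c where "0 < c" "\<And>s. s \<in> I \<Longrightarrow> P s c"
proof -
  have "\<exists>c>0. \<forall>s\<in>I. P s c"
    using assms(1,2)
  proof (induction rule: finite_induct)
    case empty
    then show ?case by (auto intro: exI[of _ 1])
  next
    case (insert i I)
    then obtain c d where "0 < c" "\<forall>s\<in>I. P s c" "0 < d" "P i d" by (metis insertCI)
    then show ?case
      by (intro exI[of _ "min c d"]) (auto intro: mono)
  qed
  then show thesis using that by blast
qed

text \<open>The finite index set is what makes the constants uniform over an infinite run: the estimates below
  hold for each residual function in a neighbourhood of \<open>\<theta>s\<close>, and finitely many neighbourhoods intersect in one.\<close>

lemma ekf_local_convergence:
  fixes l :: "nat \<Rightarrow> real^'p \<Rightarrow> real^'r" and J :: "nat \<Rightarrow> real^'p \<Rightarrow> real^'p^'r"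
  assumes fin: "finite I" and \<tau>: "\<And>t. 1 \<le> t \<Longrightarrow> \<tau> t \<in> I"
    and deriv: "\<And>s. s \<in> I \<Longrightarrow> (l s has_derivative (\<lambda>h. J s \<theta>s *v h)) (at \<theta>s)"
    and cont: "\<And>s. s \<in> I \<Longrightarrow> isCont (J s) \<theta>s"
    and zero: "\<And>s. s \<in> I \<Longrightarrow> l s \<theta>s = 0"
    and rank: "\<And>s. s \<in> I \<Longrightarrow> rank (J s \<theta>s) = CARD('p)"
    and R: "\<And>s. s \<in> I \<Longrightarrow> pos_definite (R s)" and P0: "pos_definite P0"
  shows "\<exists>N. open N \<and> \<theta>s \<in> N \<and> (\<forall>\<theta>0\<in>N. estimate l J R \<tau> \<theta>0 P0 \<longlonglongrightarrow> \<theta>s)"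
proof -
  define good where "good s m \<longleftrightarrow>
      (\<forall>x. m * (norm x)\<^sup>2 \<le> x \<bullet> (R s *v x)) \<and> (\<forall>x. m * norm (R s *v x) \<le> norm x) \<and>
      (\<forall>x. m * norm x \<le> norm (J s \<theta>s *v x)) \<and> (\<forall>x. m * norm (J s \<theta>s *v x) \<le> norm x)" for s m
  have good_mono: "good s m'" if "good s m" "m' \<le> m" for s m m'
    using that unfolding good_def by (meson mult_right_mono norm_ge_zero order_trans zero_le_power2)
  have "\<exists>m>0. good s m" if s: "s \<in> I" for s
  proof -
    obtain m1 where m1: "0 < m1" "\<And>x. m1 * (norm x)\<^sup>2 \<le> x \<bullet> (R s *v x)"
      using pos_definite_coercive[OF R[OF s]] by blast
    obtain m2 where m2: "0 < m2" "\<And>x. norm (R s *v x) \<le> m2 * norm x"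
      using matrix_vector_bound by blast
    have "inj ((*v) (J s \<theta>s))" using rank[OF s] by (simp add: full_rank_injective)
    then obtain m3 where m3: "0 < m3" "\<And>x. m3 * norm x \<le> norm (J s \<theta>s *v x)"
      using linear_inj_bounded_below_pos[OF matrix_vector_mul_linear] by blast
    obtain m4 where m4: "0 < m4" "\<And>x. norm (J s \<theta>s *v x) \<le> m4 * norm x"
      using matrix_vector_bound by blast
    define m where "m = min (min m1 (1 / m2)) (min m3 (1 / m4))"
    have m: "m \<le> m1" "m \<le> 1 / m2" "m \<le> m3" "m \<le> 1 / m4" "0 < m"
      using m1(1) m2(1) m3(1) m4(1) by (simp_all add: m_def)
    have "m * norm (R s *v x) \<le> norm x" for x
      using order_trans[OF mult_right_mono[OF m(2) norm_ge_zero], of "R s *v x" "norm x"] m2(1) m2(2)[of x]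
      by (simp add: field_simps)
    moreover have "m * norm (J s \<theta>s *v x) \<le> norm x" for x
      using order_trans[OF mult_right_mono[OF m(4) norm_ge_zero], of "J s \<theta>s *v x" "norm x"] m4(1) m4(2)[of x]
      by (simp add: field_simps)
    moreover have "m * (norm x)\<^sup>2 \<le> x \<bullet> (R s *v x)" for x
      using order_trans[OF mult_right_mono[OF m(1)] m1(2)[of x]] by simp
    moreover have "m * norm x \<le> norm (J s \<theta>s *v x)" for x
      using order_trans[OF mult_right_mono[OF m(3)] m3(2)[of x]] by simp
    ultimately show ?thesis using m(5) unfolding good_def by blast
  qed
  then obtain m where m: "0 < m" "\<And>s. s \<in> I \<Longrightarrow> good s m"
    using finite_uniform_constant[OF fin, of good] good_mono by blast
  obtain q where q: "0 < q" "\<And>x. q * (norm x)\<^sup>2 \<le> x \<bullet> (matrix_inv P0 *v x)"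
    using pos_definite_coercive[OF pos_definite_matrix_inv(1)[OF P0]] by blast
  \<comment> \<open>\<open>b\<close> bounds the Jacobians near \<open>\<theta>s\<close> and \<open>\<sigma>\<close> the innovation covariances. \<open>\<epsilon> \<le> m / 2\<close> keeps half of the lower
    bound \<open>m\<close> of the Jacobian for the residual error, and the second bound on \<open>\<epsilon>\<close> makes \<open>\<kappa>\<close> positive.\<close>
  define b where "b = 1 / m + m"
  define \<sigma> where "\<sigma> = b\<^sup>2 / q + 1 / m"
  have b: "0 < b" and \<sigma>: "0 < \<sigma>" using m(1) q(1) by (simp_all add: b_def \<sigma>_def add_nonneg_pos)
  define \<epsilon> where "\<epsilon> = min (m / 2) (m\<^sup>2 / (4 * \<sigma>))"
  have \<epsilon>: "0 < \<epsilon>" "\<epsilon> \<le> m / 2" "\<epsilon> \<le> m\<^sup>2 / (4 * \<sigma>)" using m(1) \<sigma> by (simp_all add: \<epsilon>_def)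
  define \<kappa> where "\<kappa> = m * (m / 2)\<^sup>2 / \<sigma>\<^sup>2 - \<epsilon>\<^sup>2 / m"
  have \<kappa>: "0 < \<kappa>"
  proof -
    have "\<epsilon>\<^sup>2 / m \<le> (m\<^sup>2 / (4 * \<sigma>))\<^sup>2 / m"
      using \<epsilon> m(1) by (intro divide_right_mono power_mono) auto
    also have "\<dots> < m * (m / 2)\<^sup>2 / \<sigma>\<^sup>2"
      using m(1) \<sigma> by (simp add: field_simps power2_eq_square)
    finally show ?thesis by (simp add: \<kappa>_def)
  qed
  have "\<forall>\<^sub>F \<theta> in nhds \<theta>s. \<forall>s\<in>I. norm (J s \<theta> - J s \<theta>s) \<le> \<epsilon> / 2 \<and>
      norm (l s \<theta> - l s \<theta>s - J s \<theta>s *v (\<theta> - \<theta>s)) \<le> \<epsilon> / 2 * norm (\<theta> - \<theta>s)"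
  proof (intro eventually_ball_finite[OF fin] ballI eventually_conj)
    fix s assume s: "s \<in> I"
    have "(J s \<longlongrightarrow> J s \<theta>s) (nhds \<theta>s)"
      using cont[OF s] by (simp add: continuous_at tendsto_at_iff_tendsto_nhds)
    then have "\<forall>\<^sub>F \<theta> in nhds \<theta>s. dist (J s \<theta>) (J s \<theta>s) < \<epsilon> / 2"
      using \<epsilon>(1) by (intro tendstoD) auto
    then show "\<forall>\<^sub>F \<theta> in nhds \<theta>s. norm (J s \<theta> - J s \<theta>s) \<le> \<epsilon> / 2"
      by eventually_elim (simp add: dist_norm)
    have "\<exists>d>0. \<forall>\<theta>. norm (\<theta> - \<theta>s) < d \<longrightarrow>
        norm (l s \<theta> - l s \<theta>s - J s \<theta>s *v (\<theta> - \<theta>s)) \<le> \<epsilon> / 2 * norm (\<theta> - \<theta>s)"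
      using deriv[OF s] \<epsilon>(1) unfolding has_derivative_at_alt by (meson half_gt_zero)
    then show "\<forall>\<^sub>F \<theta> in nhds \<theta>s.
        norm (l s \<theta> - l s \<theta>s - J s \<theta>s *v (\<theta> - \<theta>s)) \<le> \<epsilon> / 2 * norm (\<theta> - \<theta>s)"
      unfolding eventually_nhds_metric dist_norm .
  qed
  then obtain \<delta> where \<delta>: "0 < \<delta>" and
    near: "\<And>\<theta> s. norm (\<theta> - \<theta>s) < \<delta> \<Longrightarrow> s \<in> I \<Longrightarrow> norm (J s \<theta> - J s \<theta>s) \<le> \<epsilon> / 2 \<and>
      norm (l s \<theta> - l s \<theta>s - J s \<theta>s *v (\<theta> - \<theta>s)) \<le> \<epsilon> / 2 * norm (\<theta> - \<theta>s)"
    unfolding eventually_nhds_metric dist_norm by blast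
  define V where "V x = x \<bullet> (matrix_inv P0 *v x)" for x
  \<comment> \<open>A sublevel set of the initial quadratic form: the form never increases and stays above
    \<open>q |x|\<^sup>2\<close>, so a run that starts in \<open>N\<close> never leaves the ball of radius \<open>\<delta>\<close>.\<close>
  define N where "N = {\<theta>. V (\<theta>s - \<theta>) < q * \<delta>\<^sup>2}"
  have "open N"
    unfolding N_def V_def
    by (intro open_Collect_less continuous_intros
        bounded_linear.continuous_on[OF matrix_vector_mul_bounded_linear])
  moreover have "\<theta>s \<in> N" using q(1) \<delta> by (simp add: N_def V_def)
  moreover have "estimate l J R \<tau> \<theta>0 P0 \<longlonglongrightarrow> \<theta>s" if \<theta>0: "\<theta>0 \<in> N" for \<theta>0
  proof -
    define x where "x t = \<theta>s - estimate l J R \<tau> \<theta>0 P0 t" for t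
    define P where "P t = covar l J R \<tau> \<theta>0 P0 t" for t
    have lyapunov: "\<exists>Q. transpose Q = Q \<and> P t ** Q = mat 1 \<and> (\<forall>z. q * (norm z)\<^sup>2 \<le> z \<bullet> (Q *v z)) \<and>
        x t \<bullet> (Q *v x t) + \<kappa> * (\<Sum>i<t. (norm (x i))\<^sup>2) \<le> V (x 0)" for t
    proof (induction t)
      case 0
      have "P0 ** matrix_inv P0 = mat 1"
        using matrix_inv_right_vector[OF pos_definite_matrix_inv(2)[OF P0]]
        by (simp add: matrix_eq flip: matrix_vector_mul_assoc)
      then show ?case
        using q pos_definite_matrix_inv(1)[OF P0]
        by (intro exI[of _ "matrix_inv P0"])
           (simp add: pos_definite_def P_def covar_def V_def)
    next
      case (Suc t)
      then obtain Q where Q: "transpose Q = Q" "P t ** Q = mat 1"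
        "\<And>z. q * (norm z)\<^sup>2 \<le> z \<bullet> (Q *v z)"
        "x t \<bullet> (Q *v x t) + \<kappa> * (\<Sum>i<t. (norm (x i))\<^sup>2) \<le> V (x 0)"
        by blast
      define \<theta> s where "\<theta> = estimate l J R \<tau> \<theta>0 P0 t" and "s = \<tau> (Suc t)"
      define L e K where "L = J s \<theta>" and "e = - l s \<theta>" and "K = kalman_gain (P t) L (R s)"
      have s: "s \<in> I" by (simp add: s_def \<tau>)
      note gm = m(2)[OF s, unfolded good_def]
      have Rs: "transpose (R s) = R s" "\<And>z. m * (norm z)\<^sup>2 \<le> z \<bullet> (R s *v z)"
        "\<And>z. norm (R s *v z) \<le> 1 / m * norm z"
        using R[OF s] gm m(1) by (auto simp: pos_definite_def field_simps)
      have x': "x (Suc t) = x t - K *v e" and P': "P (Suc t) = (mat 1 - K ** L) ** P t"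
        by (simp_all add: x_def P_def estimate_def covar_def K_def L_def e_def \<theta>_def s_def
            ekf_update_def Let_def case_prod_beta linear_neg[OF matrix_vector_mul_linear])
      have "q * (norm (x t))\<^sup>2 \<le> V (x 0)"
        using Q(3)[of "x t"] Q(4) \<kappa> by (smt (verit) mult_nonneg_nonneg sum_nonneg zero_le_power2)
      also have "\<dots> < q * \<delta>\<^sup>2" using \<theta>0 by (simp add: N_def x_def estimate_def)
      finally have "norm (x t) < \<delta>"
        using q(1) \<delta> by (simp add: power2_less_imp_less)
      then have "norm (\<theta> - \<theta>s) < \<delta>" by (simp add: x_def \<theta>_def norm_minus_commute)
      note near' = near[OF this s]
      have JJ: "norm ((L - J s \<theta>s) *v z) \<le> \<epsilon> / 2 * norm z" for z
        using norm_matrix_vector_le[of "L - J s \<theta>s" z] near'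
        by (smt (verit) L_def mult_right_mono norm_ge_zero)
      have lin: "norm (J s \<theta>s *v x t - e) \<le> \<epsilon> / 2 * norm (x t)"
      proof -
        have "J s \<theta>s *v x t - e = l s \<theta> - l s \<theta>s - J s \<theta>s *v (\<theta> - \<theta>s)"
          by (simp add: x_def e_def zero[OF s] \<theta>_def matrix_vector_mult_diff_distrib)
        then show ?thesis using near' by (simp add: x_def \<theta>_def norm_minus_commute)
      qed
      have "L *v x t - e = (L - J s \<theta>s) *v x t + (J s \<theta>s *v x t - e)"
        by (simp add: matrix_vector_mult_diff_rdistrib)
      then have 1: "norm (L *v x t - e) \<le> \<epsilon> * norm (x t)"
        using norm_triangle_le[OF add_mono[OF JJ[of "x t"] lin]] by (simp add: add_diff_eq)
      have 2: "m / 2 * norm (x t) \<le> norm e"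
      proof -
        have "m * norm (x t) \<le> norm (J s \<theta>s *v x t)" using gm by blast
        also have "\<dots> \<le> norm (J s \<theta>s *v x t - e) + norm e" by (metis diff_add_cancel norm_triangle_ineq)
        also have "\<dots> \<le> m / 2 * norm (x t) + norm e"
          using order_trans[OF lin, of "m / 2 * norm (x t)"] \<epsilon> m(1) by (simp add: mult_right_mono)
        finally show ?thesis by simp
      qed
      have 3: "norm (L *v z) \<le> b * norm z" for z
      proof -
        have "L *v z = J s \<theta>s *v z + (L - J s \<theta>s) *v z"
          by (simp add: matrix_vector_mult_diff_rdistrib)
        then have "norm (L *v z) \<le> norm (J s \<theta>s *v z) + norm ((L - J s \<theta>s) *v z)"
          by (metis norm_triangle_ineq)
        also have "\<dots> \<le> 1 / m * norm z + m * norm z"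
        proof (rule add_mono)
          show "norm (J s \<theta>s *v z) \<le> 1 / m * norm z"
            using gm m(1) by (simp add: field_simps)
          show "norm ((L - J s \<theta>s) *v z) \<le> m * norm z"
            by (rule order_trans[OF JJ mult_right_mono]) (use \<epsilon> m(1) in auto)
        qed
        finally show ?thesis by (simp add: b_def algebra_simps)
      qed
      define Q' where "Q' = Q + transpose L ** matrix_inv (R s) ** L"
      have Qnn: "0 \<le> z \<bullet> (Q *v z)" for z
        using order_trans[OF _ Q(3), of 0] q(1) by simp
      note info = ekf_update_information[OF Q(1,2) Qnn Rs(1) m(1) Rs(2), where L = L, folded Q'_def K_def]
      have "x (Suc t) \<bullet> (Q' *v x (Suc t)) \<le>
          x t \<bullet> (Q *v x t) + (\<epsilon>\<^sup>2 / m - m * (m / 2)\<^sup>2 / \<sigma>\<^sup>2) * (norm (x t))\<^sup>2"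
        unfolding x' Q'_def K_def
        by (rule ekf_update_decrease[OF Q(1,2) q(1) Q(3) Rs(1) m(1) Rs(2,3), where b = b])
           (use 1 2 3 b \<sigma> m(1) in \<open>auto simp: \<sigma>_def\<close>)
      also have "\<dots> = x t \<bullet> (Q *v x t) - \<kappa> * (norm (x t))\<^sup>2"
        by (simp add: \<kappa>_def algebra_simps)
      finally have "x (Suc t) \<bullet> (Q' *v x (Suc t)) + \<kappa> * (\<Sum>i<Suc t. (norm (x i))\<^sup>2) \<le> V (x 0)"
        using Q(4) by (simp add: algebra_simps)
      moreover have "q * (norm z)\<^sup>2 \<le> z \<bullet> (Q' *v z)" for z
        using Q(3)[of z] info(2)[of z] by linarith
      ultimately show ?case
        using info(1,4) by (auto simp: P' intro!: exI[of _ Q'])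
    qed
    have "(\<Sum>i<t. (norm (x i))\<^sup>2) \<le> V (x 0) / \<kappa>" for t
    proof -
      obtain Q where "\<forall>z. q * (norm z)\<^sup>2 \<le> z \<bullet> (Q *v z)"
        "x t \<bullet> (Q *v x t) + \<kappa> * (\<Sum>i<t. (norm (x i))\<^sup>2) \<le> V (x 0)"
        using lyapunov by blast
      moreover from this(1) have "0 \<le> x t \<bullet> (Q *v x t)"
        using q(1) by (meson mult_nonneg_nonneg less_imp_le order_trans zero_le_power2)
      ultimately show ?thesis using \<kappa> by (simp add: field_simps)
    qed
    then have "summable (\<lambda>i. (norm (x i))\<^sup>2)"
      by (intro summableI_nonneg_bounded) auto
    then have "(\<lambda>i. (norm (x i))\<^sup>2) \<longlonglongrightarrow> 0" by (rule summable_LIMSEQ_zero)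
    then have "(\<lambda>i. sqrt ((norm (x i))\<^sup>2)) \<longlonglongrightarrow> sqrt 0" by (rule tendsto_real_sqrt)
    then have "x \<longlonglongrightarrow> 0" by (simp add: tendsto_norm_zero_iff)
    then have "(\<lambda>t. \<theta>s - x t) \<longlonglongrightarrow> \<theta>s - 0" by (intro tendsto_intros)
    then show ?thesis by (simp add: x_def)
  qed
  ultimately show ?thesis by blast
qed

section \<open>Convergence of the cumulative loss\<close>

theorem theorem1:
  fixes S :: "('n::finite, 'm::finite, 'p::finite) ocs"
    and xs :: "real^'p \<Rightarrow> nat \<Rightarrow> real^'n" and us :: "real^'p \<Rightarrow> nat \<Rightarrow> real^'m"
    and hm :: "real^('n + 'm) \<Rightarrow> real^'r"
    and obs v :: "nat \<Rightarrow> real^'r" and R :: "nat \<Rightarrow> real^'r^'r"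
    and \<tau> :: "nat \<Rightarrow> nat" and \<theta>s :: "real^'p" and P0 :: "real^'p^'p"
    and l :: "nat \<Rightarrow> real^'p \<Rightarrow> real^'r" and J :: "nat \<Rightarrow> real^'p \<Rightarrow> real^'p^'r"
  assumes "smooth_ocs S" and "twice_differentiable hm"
    and "\<And>\<theta>. minimizer S \<theta> (xs \<theta>) (us \<theta>)"
    and "\<And>t. t \<le> horizon S \<Longrightarrow>
           continuously_differentiable (\<lambda>\<theta>. traj_slice S (xs \<theta>) (us \<theta>) t)"
    and "\<And>\<theta>. generator_wellposed S \<theta> (xs \<theta>) (us \<theta>)"
    and "\<And>t. t \<le> horizon S \<Longrightarrow> obs t = hm (traj_slice S (xs \<theta>s) (us \<theta>s) t) + v t"
    and "twice_differentiable (loss S xs us hm obs)"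
    and "loss S xs us hm obs \<theta>s = 0"
    and "\<And>t. t \<le> horizon S \<Longrightarrow> pos_definite (R t)" and "pos_definite P0"
    and "\<And>t. 1 \<le> t \<Longrightarrow> \<tau> t \<le> horizon S" and "\<And>t. 1 \<le> t \<Longrightarrow> t \<le> horizon S \<Longrightarrow> \<tau> t = t"
    and l_def: "l = traj_residual S xs us hm obs"
    and J_def: "J = residual_jacobian S xs us hm obs"
    and full_rank: "\<forall>\<^sub>F \<theta> in nhds \<theta>s. \<forall>t\<ge>1. rank (J (\<tau> t) \<theta>) = CARD('p)"
  shows "\<exists>N. open N \<and> \<theta>s \<in> N \<and>
           (\<forall>\<theta>0\<in>N. full_rank_along l J R \<tau> \<theta>0 P0 \<and> bounded_along l J R \<tau> \<theta>0 P0
                    \<and> inequalities_along \<theta>s l J R \<tau> \<theta>0 P0 \<longrightarrow>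
              (\<lambda>t. loss S xs us hm obs (estimate l J R \<tau> \<theta>0 P0 t)) \<longlonglongrightarrow> 0)"
proof -
  have C1: "continuously_differentiable (\<lambda>\<theta>. traj_slice S (xs \<theta>) (us \<theta>) t)" if "t \<le> horizon S" for t
    using assms(4)[OF that] .
  have diff: "(\<lambda>\<theta>. traj_slice S (xs \<theta>) (us \<theta>) t) differentiable (at \<theta>)" if "t \<le> horizon S" for t \<theta>
    using C1[OF that] unfolding continuously_differentiable_def differentiable_def by blast
  have slice: "((\<lambda>\<theta>. traj_slice S (xs \<theta>) (us \<theta>) t) has_derivative
      (\<lambda>h. slice_sens S \<theta> (xs \<theta>) (us \<theta>) t *v h)) (at \<theta>)" if "t \<le> horizon S" for t \<theta>
    using assms(1,3) diff assms(5) that by (rule has_derivative_traj_slice)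
  define I where "I = \<tau> ` {1..}"
  have I: "s \<le> horizon S" if "s \<in> I" for s
    using that assms(11) by (auto simp: I_def)
  have zero: "l s \<theta>s = 0" if "s \<le> horizon S" for s
  proof -
    have "(\<Sum>s\<le>horizon S. (norm (l s \<theta>s))\<^sup>2) = 0"
      using assms(8) by (simp add: loss_def l_def)
    then show ?thesis using that by (simp add: sum_nonneg_eq_0_iff)
  qed
  have "\<exists>N. open N \<and> \<theta>s \<in> N \<and> (\<forall>\<theta>0\<in>N. estimate l J R \<tau> \<theta>0 P0 \<longlonglongrightarrow> \<theta>s)"
  proof (rule ekf_local_convergence[where I = I])
    show "finite I" using I by (auto intro: finite_subset[of _ "{..horizon S}"])
    show "\<tau> t \<in> I" if "1 \<le> t" for t using that by (simp add: I_def)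
    show "(l s has_derivative (\<lambda>h. J s \<theta>s *v h)) (at \<theta>s)" if "s \<in> I" for s
      unfolding l_def J_def using assms(2) slice[OF I[OF that]] by (rule has_derivative_traj_residual)
    show "isCont (J s) \<theta>s" if "s \<in> I" for s
      unfolding J_def using assms(2) C1[OF I[OF that]] slice[OF I[OF that]] by (rule isCont_residual_jacobian)
    show "l s \<theta>s = 0" if "s \<in> I" for s using zero I that by blast
    show "rank (J s \<theta>s) = CARD('p)" if "s \<in> I" for s
      using eventually_nhds_x_imp_x[OF full_rank] that by (auto simp: I_def)
    show "pos_definite (R s)" if "s \<in> I" for s using assms(9) I that by blast
    show "pos_definite P0" by fact
  qed
  then obtain N where N: "open N" "\<theta>s \<in> N" "\<And>\<theta>0. \<theta>0 \<in> N \<Longrightarrow> estimate l J R \<tau> \<theta>0 P0 \<longlonglongrightarrow> \<theta>s"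
    by blast
  have "isCont (loss S xs us hm obs) \<theta>s"
    using assms(7) unfolding twice_differentiable_def by (blast intro: has_derivative_continuous)
  then have "(\<lambda>t. loss S xs us hm obs (estimate l J R \<tau> \<theta>0 P0 t)) \<longlonglongrightarrow> 0" if "\<theta>0 \<in> N" for \<theta>0
    using isCont_tendsto_compose[OF _ N(3)[OF that]] assms(8) by metis
  then show ?thesis using N(1,2) by blast
qed

end
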